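(* Let $\sigma\in\partial\mathcal{D}$ be a singular matrix, and let $\rho\in \mathrm{H}_{n,+,1}$ be an entangled state (i.e. $\rho\notin\mathcal{D}$). Then $$E_R(\rho)=S(\rho\|\sigma)$$ (i.e. $\sigma$ is a closest separable state (CSS) of $\rho$) if and only if there exist a Hermitian matrix $\psi\in \mathrm{H}_n$ with $\psi\neq P_\sigma$, satisfying $$\mathrm{Tr}(\psi\sigma')\le \mathrm{Tr}(\psi\sigma)=1\ \text{ for all }\sigma'\in\mathcal{D},$$ and vanishing outside the support of $\sigma$ (i.e. $\sigma\mathbf{x}=0$ implies $\psi\mathbf{x}=0$), and a real number $x$ with $0<x\le x_{\max}\le 1$, such that $$\rho=(1-x)\sigma+x\,L_\sigma^{\ddag}(\psi).$$ Here $x_{\max}=x_{\max}(\sigma,\psi)$ is the maximum value of $x$ not greater than $1$ such that $(1-x)\sigma+xL_\sigma^{\ddag}(\psi)\in \mathrm{H}_{n,+,1}$.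
   Context: $\mathrm{H}_n$ is the real vector space of $n\times n$ complex Hermitian matrices; $\mathrm{H}_{n,+}\subset \mathrm{H}_n$ is the cone of positive semidefinite matrices, and $\mathrm{H}_{n,+,1}$ is the set of elements of $\mathrm{H}_{n,+}$ of trace one (states). Fix $n=n_1n_2\cdots n_s$ and identify $\mathbb{C}^n=\mathbb{C}^{n_1}\otimes\cdots\otimes\mathbb{C}^{n_s}$. $\mathcal{D}\subset \mathrm{H}_{n,+,1}$ denotes either the set of separable states (the convex hull of the product states $\rho_1\otimes\cdots\otimes\rho_s$ with $\rho_i\in \mathrm{H}_{n_i,+,1}$) or the set of PPT states (states all of whose partial transposes, with respect to every subset of the tensor factors, are positive semidefinite); the result is asserted for either choice. $\partial\mathcal{D}$ is the boundary of $\mathcal{D}$ relative to the affine space of trace-one Hermitian matrices. A state is called entangled if it is not in $\mathcal{D}$. The relative entropy is $S(\rho\|\sigma)=\mathrm{Tr}(\rho\log\rho-\rho\log\sigma)$ (natural logarithm; equal to $+\infty$ if $\ker\sigma\not\subseteq\ker\rho$; otherwise $\rho\log\sigma$ is computed on the support of $\sigma$; $0\log 0=0$), and $E_R(\rho)=\min_{\sigma'\in\mathcal{D}}S(\rho\|\sigma')$. Any $\sigma\in\mathcal{D}$ with $E_R(\rho)=S(\rho\|\sigma)$ is called a closest separable state (CSS) of $\rho$. $P_\sigma$ is the orthogonal projection onto the support (range) of $\sigma$. For singular nonzero $\sigma\in \mathrm{H}_{n,+}$ of rank $r$, work in an orthonormal eigenbasis of $\sigma$ with $\sigma=\mathrm{diag}(s_1,\dots,s_n)$,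 $s_1\ge\dots\ge s_r>0=s_{r+1}=\dots=s_n$. In this basis define linear operators $L_\sigma,L_\sigma^{\ddag}:\mathrm{H}_n\to \mathrm{H}_n$ as follows: for $\xi=[\xi_{kl}]$ and $k,l\le r$, $[L_\sigma(\xi)]_{kl}=\xi_{kl}\frac{\log s_k-\log s_l}{s_k-s_l}$ and $[L_\sigma^{\ddag}(\xi)]_{kl}=\xi_{kl}\frac{s_k-s_l}{\log s_k-\log s_l}$ (the quotients being $1/s_k$ and $s_k$, respectively, when $s_k=s_l$), and all entries with $k>r$ or $l>r$ are set to $0$. ($L_\sigma^{\ddag}$ is the Moore-Penrose inverse of $L_\sigma$.) *)

theory Defs
  imports "HOL-Analysis.Analysis"
begin

section \<open>Hermitian matrices and states\<close>

text \<open>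
  The tensor factors have sizes \<open>d k\<close> that vary with the factor \<open>k\<close>, so matrices over
  an arbitrary finite index set \<open>I\<close> are needed besides the type \<^typ>\<open>complex^'n^'n\<close>.
\<close>

definition hermitian_on :: "'a set \<Rightarrow> ('a \<Rightarrow> 'a \<Rightarrow> complex) \<Rightarrow> bool" where
  "hermitian_on I A \<longleftrightarrow> (\<forall>i\<in>I. \<forall>j\<in>I. A j i = cnj (A i j))"

definition psd_on :: "'a set \<Rightarrow> ('a \<Rightarrow> 'a \<Rightarrow> complex) \<Rightarrow> bool" where
  "psd_on I A \<longleftrightarrow> hermitian_on I A \<and>
     (\<forall>v. 0 \<le> Re (\<Sum>i\<in>I. \<Sum>j\<in>I. cnj (v i) * A i j * v j))"

definition state_on :: "'a set \<Rightarrow> ('a \<Rightarrow> 'a \<Rightarrow> complex) \<Rightarrow> bool" where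
  "state_on I A \<longleftrightarrow> psd_on I A \<and> (\<Sum>i\<in>I. A i i) = 1"

definition hermitian_mats :: "(complex^'n^'n) set" where
  "hermitian_mats = {A. hermitian_on UNIV (\<lambda>i j. A $ i $ j)}"

definition psd_mats :: "(complex^'n^'n) set" where
  "psd_mats = {A. psd_on UNIV (\<lambda>i j. A $ i $ j)}"

definition states :: "(complex^'n^'n) set" where
  "states = {A. state_on UNIV (\<lambda>i j. A $ i $ j)}"


section \<open>Separable and PPT states\<close>

text \<open>
  The factors are labelled by a finite type \<open>'s\<close>. The identification of \<open>\<complex>\<^sup>n\<close> with the
  tensor product of the \<open>\<complex>\<^bsup>d k\<^esup>\<close> is a bijection \<open>e\<close> from \<open>'n\<close> onto the multi-indices:
  \<open>e i k\<close> is the \<open>k\<close>-th component of the multi-index of the \<open>i\<close>-th standard basis vector.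
  In particular \<open>CARD('n)\<close> is the product of all \<open>d k\<close>.
\<close>

definition tensor_index :: "('s::finite \<Rightarrow> nat) \<Rightarrow> ('n::finite \<Rightarrow> 's \<Rightarrow> nat) \<Rightarrow> bool" where
  "tensor_index d e \<longleftrightarrow> (\<forall>k. 1 \<le> d k) \<and> bij_betw e UNIV {m. \<forall>k. m k < d k}"

definition tensor_mat ::
    "('n::finite \<Rightarrow> 's::finite \<Rightarrow> nat) \<Rightarrow> ('s \<Rightarrow> nat \<Rightarrow> nat \<Rightarrow> complex) \<Rightarrow> complex^'n^'n" where
  "tensor_mat e R = (\<chi> i j. \<Prod>k\<in>UNIV. R k (e i k) (e j k))"

definition product_states ::
    "('s::finite \<Rightarrow> nat) \<Rightarrow> ('n::finite \<Rightarrow> 's \<Rightarrow> nat) \<Rightarrow> (complex^'n^'n) set" where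
  "product_states d e = {tensor_mat e R | R. \<forall>k. state_on {..<d k} (R k)}"

definition separable_states ::
    "('s::finite \<Rightarrow> nat) \<Rightarrow> ('n::finite \<Rightarrow> 's \<Rightarrow> nat) \<Rightarrow> (complex^'n^'n) set" where
  "separable_states d e = convex hull (product_states d e)"

text \<open>
  Transposition of the factors in \<open>K\<close> exchanges the \<open>k\<close>-components of the row and the
  column multi-index for all \<open>k \<in> K\<close>.
\<close>

definition mix_index :: "('n::finite \<Rightarrow> 's::finite \<Rightarrow> nat) \<Rightarrow> 's set \<Rightarrow> 'n \<Rightarrow> 'n \<Rightarrow> 'n" where
  "mix_index e K i j = inv e (\<lambda>k. if k \<in> K then e j k else e i k)"

definition partial_transpose ::
    "('n::finite \<Rightarrow> 's::finite \<Rightarrow> nat) \<Rightarrow> 's set \<Rightarrow> complex^'n^'n \<Rightarrow> complex^'n^'n" where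
  "partial_transpose e K A = (\<chi> i j. A $ mix_index e K i j $ mix_index e K j i)"

definition ppt_states :: "('n::finite \<Rightarrow> 's::finite \<Rightarrow> nat) \<Rightarrow> (complex^'n^'n) set" where
  "ppt_states e = {\<rho> \<in> states. \<forall>K. partial_transpose e K \<rho> \<in> psd_mats}"

definition state_boundary :: "(complex^'n^'n) set \<Rightarrow> (complex^'n^'n) set" where
  "state_boundary D = top_of_set {A \<in> hermitian_mats. trace A = 1} frontier_of D"


section \<open>Spectral calculus\<close>

definition adj :: "complex^'n^'m \<Rightarrow> complex^'m^'n" where
  "adj A = (\<chi> i j. cnj (A $ j $ i))"

definition diag_mat :: "('n \<Rightarrow> real) \<Rightarrow> complex^'n^'n" where
  "diag_mat s = (\<chi> k l. if k = l then of_real (s k) else 0)"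

text \<open>The columns of \<open>U\<close> are an orthonormal basis in which \<open>A\<close> becomes \<open>diag(s)\<close>.\<close>

definition eigenbasis :: "complex^'n^'n \<Rightarrow> complex^'n^'n \<Rightarrow> ('n \<Rightarrow> real) \<Rightarrow> bool" where
  "eigenbasis A U s \<longleftrightarrow> adj U ** U = mat 1 \<and> adj U ** A ** U = diag_mat s"

text \<open>
  An arbitrary choice of eigenbasis, meaningful for Hermitian \<open>A\<close>. The objects defined
  from it below do not depend on the choice. The eigenvalues are not sorted: the condition
  \<open>k \<le> r\<close> of a decreasing enumeration of the eigenvalues of a positive semidefinite matrix
  of rank \<open>r\<close> reads \<open>s k > 0\<close>.
\<close>

definition some_eigenbasis :: "complex^'n^'n \<Rightarrow> (complex^'n^'n) \<times> ('n \<Rightarrow> real)" where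
  "some_eigenbasis A = (SOME (U, s). eigenbasis A U s)"

text \<open>The logarithm on the support, extended by zero to the kernel.\<close>

definition mat_log :: "complex^'n^'n \<Rightarrow> complex^'n^'n" where
  "mat_log A = (case some_eigenbasis A of (U, s) \<Rightarrow>
     U ** diag_mat (\<lambda>k. if s k > 0 then ln (s k) else 0) ** adj U)"

definition L_ddag :: "complex^'n^'n \<Rightarrow> complex^'n^'n \<Rightarrow> complex^'n^'n" where
  "L_ddag \<sigma> \<xi> = (case some_eigenbasis \<sigma> of (U, s) \<Rightarrow>
     U ** (\<chi> k l. if s k > 0 \<and> s l > 0
             then (adj U ** \<xi> ** U) $ k $ l *
               of_real (if s k = s l then s k else (s k - s l) / (ln (s k) - ln (s l)))
             else 0) ** adj U)"

definition support_proj :: "complex^'n^'n \<Rightarrow> complex^'n^'n" where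
  "support_proj A = (THE P. P \<in> hermitian_mats \<and> P ** P = P \<and>
     range (\<lambda>x. P *v x) = range (\<lambda>x. A *v x))"


section \<open>Relative entropy of entanglement\<close>

definition rel_entropy :: "complex^'n^'n \<Rightarrow> complex^'n^'n \<Rightarrow> ereal" where
  "rel_entropy \<rho> \<sigma> =
     (if \<forall>x. \<sigma> *v x = 0 \<longrightarrow> \<rho> *v x = 0
      then ereal (Re (trace (\<rho> ** mat_log \<rho> - \<rho> ** mat_log \<sigma>))) else \<infinity>)"

text \<open>
  For compact nonempty \<open>D\<close> the infimum is a minimum, \<open>rel_entropy \<rho>\<close> being lower
  semicontinuous.
\<close>

definition rel_entropy_ent :: "(complex^'n^'n) set \<Rightarrow> complex^'n^'n \<Rightarrow> ereal" where
  "rel_entropy_ent D \<rho> = (INF \<sigma>'\<in>D. rel_entropy \<rho> \<sigma>')"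

text \<open>\<open>GREATEST\<close> is the maximum; it exists here since \<open>x = 0\<close> is admissible and \<^term>\<open>states\<close> is closed.\<close>

definition x_max :: "complex^'n^'n \<Rightarrow> complex^'n^'n \<Rightarrow> real" where
  "x_max \<sigma> \<psi> = (GREATEST x. x \<le> 1 \<and> (1 - x) *\<^sub>R \<sigma> + x *\<^sub>R L_ddag \<sigma> \<psi> \<in> states)"

end

theory Submission
  imports Defs
begin

text \<open>
  Let \<open>U\<close>, \<open>s\<close> be an eigenbasis of \<open>\<sigma>\<close>. For a state \<open>A\<close> one compares \<open>Tr \<rho> log A\<close> with its
  linearization \<open>Tr \<rho> log \<sigma> + Tr L\<^sub>\<sigma>(\<rho>) (A - \<sigma>)\<close>. Replacing \<open>\<sigma>\<close>, \<open>A\<close> by \<open>\<sigma> + x\<close>, \<open>A + x\<close>, the error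
  tends to \<open>0\<close> for \<open>x \<rightarrow> \<infinity>\<close>, and by the second-order resolvent expansion its derivative is a
  nonnegative expression, quadratic in \<open>A - \<sigma>\<close>. Hence the linearization is an upper bound, which
  makes the first-order condition \<open>Tr L\<^sub>\<sigma>(\<rho>) (\<sigma>' - \<sigma>) \<le> 0\<close> on \<open>D\<close> sufficient for \<open>\<sigma>\<close> to be a closest
  state. An upper bound on the derivative shows that the error along \<open>\<sigma> + t (\<tau> - \<sigma>)\<close> is \<open>o(t)\<close> if \<open>\<tau>\<close>
  is positive definite, although \<open>\<sigma>\<close> is singular; as \<open>D\<close> contains a multiple of the identity, the
  condition is also necessary. If it holds, then \<open>\<psi> = L\<^sub>\<sigma>(\<rho>)\<close> and \<open>x = 1\<close> are as required;
  conversely, \<open>\<rho> = (1 - x) \<sigma> + x L\<^sub>\<sigma>\<^sup>\<ddagger>(\<psi>)\<close> gives \<open>L\<^sub>\<sigma>(\<rho>) = (1 - x) P\<^sub>\<sigma> + x \<psi>\<close>.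
\<close>

section \<open>Matrix algebra\<close>

lemma adj_nth [simp]: "adj A $ i $ j = cnj (A $ j $ i)"
  by (simp add: adj_def)

lemma adj_adj [simp]: "adj (adj A) = A"
  by (simp add: vec_eq_iff)

lemma adj_matrix_mul: "adj (A ** B) = adj B ** adj A"
  by (simp add: vec_eq_iff matrix_matrix_mult_def mult.commute)

lemma adj_add: "adj (A + B) = adj A + adj B"
  by (simp add: vec_eq_iff)

lemma adj_diff: "adj (A - B) = adj A - adj B"
  by (simp add: vec_eq_iff)

lemma adj_scaleR: "adj (c *\<^sub>R A) = c *\<^sub>R adj A"
  by (simp add: vec_eq_iff)

lemma adj_diag_mat [simp]: "adj (diag_mat s) = diag_mat s"
  by (auto simp add: vec_eq_iff diag_mat_def)

lemma hermitian_mats_iff: "A \<in> hermitian_mats \<longleftrightarrow> adj A = A"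
  unfolding hermitian_mats_def hermitian_on_def by (simp add: vec_eq_iff) metis

lemma diag_mat_mul_nth [simp]: "(diag_mat s ** A) $ i $ j = of_real (s i) * A $ i $ j"
proof -
  have "(diag_mat s ** A) $ i $ j = (\<Sum>k\<in>UNIV. if i = k then of_real (s i) * A $ k $ j else 0)"
    unfolding matrix_matrix_mult_def diag_mat_def vec_lambda_beta by (intro sum.cong) auto
  then show ?thesis by simp
qed

lemma mul_diag_mat_nth [simp]: "(A ** diag_mat s) $ i $ j = A $ i $ j * of_real (s j)"
  by (simp add: matrix_matrix_mult_def diag_mat_def if_distrib sum.delta cong: if_cong)

lemma diag_mat_mul_diag_mat: "diag_mat s ** diag_mat t = diag_mat (\<lambda>k. s k * t k)"
  by (simp add: vec_eq_iff) (simp add: diag_mat_def)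

lemma diag_mat_1: "diag_mat (\<lambda>k. 1) = mat 1"
  by (simp add: vec_eq_iff diag_mat_def mat_def)

lemma matrix_add_rdistrib: "(B + C) ** A = B ** A + (C :: complex^'n^'m) ** A"
  by (simp add: vec_eq_iff matrix_matrix_mult_def algebra_simps sum.distrib)

lemma matrix_mul_diff_ldistrib: "A ** (B - C) = A ** B - A ** (C :: complex^'n^'m)"
  by (simp add: vec_eq_iff matrix_matrix_mult_def algebra_simps sum_subtractf)

lemma matrix_mul_diff_rdistrib: "(B - C) ** A = B ** A - (C :: complex^'n^'m) ** A"
  by (simp add: vec_eq_iff matrix_matrix_mult_def algebra_simps sum_subtractf)

lemma matrix_mul_scaleR_left: "(c *\<^sub>R A) ** B = c *\<^sub>R (A ** (B :: complex^'n^'m))"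
  by (simp add: vec_eq_iff matrix_matrix_mult_def scaleR_sum_right)

lemma matrix_mul_scaleR_right: "A ** (c *\<^sub>R B) = c *\<^sub>R (A ** (B :: complex^'n^'m))"
  by (simp add: vec_eq_iff matrix_matrix_mult_def scaleR_sum_right)

lemma matrix_vector_mul_scaleR: "A *v (c *\<^sub>R v) = c *\<^sub>R (A *v (v :: complex^'n))"
  by (simp add: vec_eq_iff matrix_vector_mult_def scaleR_sum_right)

lemma trace_scaleR: "trace (c *\<^sub>R A) = c *\<^sub>R trace (A :: complex^'n^'n)"
  by (simp add: trace_def scaleR_sum_right)

lemma trace_matrix_mul:
  "trace (A ** B) = (\<Sum>k\<in>UNIV. \<Sum>l\<in>UNIV. A $ k $ l * (B :: complex^'n^'n) $ l $ k)"
  by (simp add: trace_def matrix_matrix_mult_def)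

lemma trace_unitary_conj:
  fixes U :: "complex^'n^'n"
  assumes "adj U ** U = mat 1"
  shows "trace (adj U ** A ** U) = trace A"
proof -
  have "U ** adj U = mat 1"
    using assms by (simp add: matrix_left_right_inverse)
  then show ?thesis
    by (subst trace_mul_sym) (simp add: matrix_mul_assoc)
qed

lemma eigenbasisD:
  fixes A :: "complex^'n^'n"
  assumes "eigenbasis A U s"
  shows "adj U ** U = mat 1" "U ** adj U = mat 1" "A = U ** diag_mat s ** adj U"
proof -
  show 1: "adj U ** U = mat 1"
    using assms by (simp add: eigenbasis_def)
  show 2: "U ** adj U = mat 1"
    using 1 by (simp add: matrix_left_right_inverse)
  have "U ** (adj U ** A ** U) ** adj U = (U ** adj U) ** A ** (U ** adj U)"
    by (simp add: matrix_mul_assoc)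
  then show "A = U ** diag_mat s ** adj U"
    using assms 2 by (simp add: eigenbasis_def)
qed

section \<open>The spectral theorem\<close>

text \<open>The Hermitian inner product, antilinear in the first argument. The operation
  \<open>\<bullet>\<close> on \<open>complex^'n\<close> is its real part, so complex orthogonality
  is a condition on \<open>cip\<close>.\<close>

definition cip :: "complex^'n \<Rightarrow> complex^'n \<Rightarrow> complex" where
  "cip u v = (\<Sum>i\<in>UNIV. cnj (u $ i) * v $ i)"

lemma inner_eq_Re_cip: "u \<bullet> v = Re (cip u v)"
  by (simp add: cip_def inner_vec_def inner_complex_def)

lemma cip_cnj: "cip v u = cnj (cip u v)"
  by (simp add: cip_def mult.commute)

lemma cip_smult_left: "cip (c *s u) v = cnj c * cip u v"
  by (simp add: cip_def sum_distrib_left mult_ac)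

lemma cip_add_right: "cip u (v + w) = cip u v + cip u w"
  by (simp add: cip_def algebra_simps sum.distrib)

lemma cip_scaleR_right: "cip u (c *\<^sub>R v) = c *\<^sub>R cip u v"
  by (simp add: cip_def scaleR_sum_right)

lemma cip_matrix_adj: "cip (A *v u) v = cip u (adj A *v v)"
proof -
  have "cip (A *v u) v = (\<Sum>i\<in>UNIV. \<Sum>j\<in>UNIV. cnj (A $ i $ j) * cnj (u $ j) * v $ i)"
    by (simp add: cip_def matrix_vector_mult_def sum_distrib_right)
  also have "\<dots> = (\<Sum>j\<in>UNIV. \<Sum>i\<in>UNIV. cnj (A $ i $ j) * cnj (u $ j) * v $ i)"
    by (rule sum.swap)
  also have "\<dots> = cip u (adj A *v v)"
    by (simp add: cip_def matrix_vector_mult_def sum_distrib_left mult_ac)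
  finally show ?thesis .
qed

lemma cip_self: "cip u u = of_real ((norm u)\<^sup>2)"
proof -
  have "Im (cip u u) = 0"
    by (simp add: cip_def mult.commute)
  moreover have "Re (cip u u) = (norm u)\<^sup>2"
    by (simp add: inner_eq_Re_cip[symmetric] power2_norm_eq_inner)
  ultimately show ?thesis
    by (simp add: complex_eq_iff)
qed

text \<open>Real dimension count: the vectors \<open>u i\<close> and \<open>\<i> *s u i\<close> are
  fewer than the real dimension 2n. Orthogonality to \<open>u i\<close> kills the real part of
  \<open>cip (u i) y\<close>, orthogonality to \<open>\<i> *s u i\<close> its imaginary
  part.\<close>

lemma exists_orthogonal_vector:
  fixes u :: "'n::finite \<Rightarrow> complex^'n"
  assumes "F \<noteq> UNIV"
  shows "\<exists>v. v \<noteq> 0 \<and> (\<forall>i\<in>F. cip (u i) v = 0)"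
proof -
  let ?T = "u ` F \<union> (\<lambda>i. \<i> *s u i) ` F"
  have "card ?T \<le> card F + card F"
    by (intro order_trans[OF card_Un_le] add_mono card_image_le) auto
  moreover have "card F < CARD('n)"
    using assms by (simp add: psubset_card_mono psubset_eq)
  ultimately have "card ?T < DIM(complex^'n)"
    by simp
  then have "dim (span ?T) < DIM(complex^'n)"
    using dim_le_card[of ?T ?T] by (simp add: span_superset)
  then obtain y where y: "y \<noteq> 0" "\<And>w. w \<in> span ?T \<Longrightarrow> orthogonal y w"
    using orthogonal_to_subspace_exists[of "span ?T"] by (auto simp: span_span)
  have "cip (u i) y = 0" if "i \<in> F" for i
  proof -
    have "orthogonal y (u i)" "orthogonal y (\<i> *s u i)"
      using that by (auto intro!: y(2) span_base)
    then have "Re (cip (u i) y) = 0" "Re (cip (\<i> *s u i) y) = 0"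
      by (simp_all add: orthogonal_def inner_commute[of y] inner_eq_Re_cip[symmetric])
    then show ?thesis
      by (simp add: cip_smult_left complex_eq_iff)
  qed
  with y(1) show ?thesis by blast
qed

text \<open>A maximizer \<open>u\<close> of the Rayleigh quotient on the unit sphere of
  \<open>W\<close> is an eigenvector: the form of \<open>B\<close>, which is \<open>f u\<close>
  times the identity minus \<open>A\<close>, is nonnegative on \<open>W\<close> and zero at
  \<open>u\<close>, and this forces \<open>B u = 0\<close>.\<close>

lemma exists_eigenvector_in_subspace:
  fixes A :: "complex^'n^'n"
  assumes "adj A = A" and "subspace W" and inv: "\<And>v. v \<in> W \<Longrightarrow> A *v v \<in> W"
    and "v0 \<in> W" "v0 \<noteq> 0"
  shows "\<exists>u c. u \<in> W \<and> norm u = 1 \<and> A *v u = c *\<^sub>R u"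
proof -
  define f where "f v = v \<bullet> (A *v v)" for v
  have sym: "v \<bullet> (A *v w) = (A *v v) \<bullet> w" for v w
    by (simp add: inner_eq_Re_cip cip_matrix_adj assms(1))
  have "compact (W \<inter> sphere 0 1)"
    by (intro closed_Int_compact closed_subspace assms compact_sphere)
  moreover have "v0 /\<^sub>R norm v0 \<in> W \<inter> sphere 0 1"
    using assms by (simp add: subspace_scale)
  moreover have "continuous_on (W \<inter> sphere 0 1) f"
    unfolding f_def
    by (intro continuous_intros linear_continuous_on matrix_vector_mul_bounded_linear)
  ultimately obtain u where u: "u \<in> W" "norm u = 1" and
    max: "\<And>v. v \<in> W \<Longrightarrow> norm v = 1 \<Longrightarrow> f v \<le> f u"
    using continuous_attains_sup[of "W \<inter> sphere 0 1" f] by (metis (no_types, lifting) IntE IntI empty_iff mem_sphere_0)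
  define B where "B v = f u *\<^sub>R v - A *v v" for v
  have B_pos: "0 \<le> v \<bullet> B v" if "v \<in> W" for v
  proof (cases "v = 0")
    case False
    have "f (v /\<^sub>R norm v) \<le> f u"
      using False that assms(2) by (intro max) (auto simp: subspace_scale)
    moreover have "f (v /\<^sub>R norm v) = f v / (norm v)\<^sup>2"
      by (simp add: f_def matrix_vector_mul_scaleR power2_eq_square divide_inverse mult_ac)
    ultimately have "f v \<le> f u * (norm v)\<^sup>2"
      using False by (simp add: divide_le_eq)
    then show ?thesis
      by (simp add: B_def f_def inner_diff_right power2_norm_eq_inner)
  qed (simp add: B_def)
  have B_lin: "B (v + t *\<^sub>R w) = B v + t *\<^sub>R B w" for v w t
    by (simp add: B_def algebra_simps matrix_vector_mul_scaleR matrix_vector_right_distrib)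
  have B_sym: "v \<bullet> B w = B v \<bullet> w" for v w
    by (simp add: B_def inner_diff_right inner_diff_left sym)
  have uBu: "u \<bullet> B u = 0"
    using u by (simp add: B_def f_def inner_diff_right norm_eq_1)
  have BuW: "B u \<in> W"
    unfolding B_def using u assms by (intro subspace_diff subspace_scale) auto
  let ?b = "B u \<bullet> B u" and ?q = "B u \<bullet> B (B u)"
  \<comment> \<open>The form of \<open>B\<close> on the line through \<open>u\<close> in direction
    \<open>B u\<close>. It has no constant term and is nonnegative, so its linear coefficient, twice
    the squared norm of \<open>B u\<close>, must vanish.\<close>
  have quad: "0 \<le> 2 * t * ?b + t\<^sup>2 * ?q" for t
  proof -
    have "0 \<le> (u + t *\<^sub>R B u) \<bullet> B (u + t *\<^sub>R B u)"
      using u BuW assms(2) by (intro B_pos subspace_add subspace_scale)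
    also have "\<dots> = 2 * t * ?b + t\<^sup>2 * ?q"
      using uBu B_sym[of u "B u"]
      by (simp add: B_lin inner_add_left inner_add_right inner_commute power2_eq_square distrib_left)
    finally show ?thesis .
  qed
  have "?b = 0"
  proof (rule ccontr)
    assume "?b \<noteq> 0"
    then have b: "?b > 0" by simp
    show False
    proof (cases "?q = 0")
      case True
      then show False using quad[of "-1"] b by simp
    next
      case False
      then have q: "?q > 0" using B_pos[OF BuW] by simp
      \<comment> \<open>If \<open>?b > 0\<close>, the quadratic is negative at its minimizer
        \<open>- ?b / ?q\<close>.\<close>
      have "2 * (- ?b / ?q) * ?b + (- ?b / ?q)\<^sup>2 * ?q = - (?b * ?b / ?q)"
        using q by (simp add: power2_eq_square field_simps del: inner_eq_zero_iff)
      moreover have "?b * ?b / ?q > 0"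
        using b q by (intro divide_pos_pos mult_pos_pos)
      ultimately show False using quad[of "- ?b / ?q"] by linarith
    qed
  qed
  then have "A *v u = f u *\<^sub>R u"
    by (simp add: B_def)
  with u show ?thesis by blast
qed

text \<open>Induction on the set of indices that already carry an orthonormal eigenvector. The
  orthogonal complement of these vectors is invariant because \<open>A\<close> is Hermitian, and
  nonzero as long as an index is left.\<close>

lemma hermitian_eigenbasis_exists:
  fixes A :: "complex^'n^'n"
  assumes "adj A = A"
  shows "\<exists>U s. eigenbasis A U s"
proof -
  have "\<exists>u c. (\<forall>i\<in>F. \<forall>j\<in>F. cip (u i) (u j) = (if i = j then 1 else 0)) \<and>
     (\<forall>i\<in>F. A *v u i = c i *\<^sub>R u i)" if "finite F" for F :: "'n set"
    using that
  proof (induction F)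
    case empty
    show ?case by simp
  next
    case (insert x F)
    then obtain u c where u: "\<forall>i\<in>F. \<forall>j\<in>F. cip (u i) (u j) = (if i = j then 1 else 0)"
      and c: "\<forall>i\<in>F. A *v u i = c i *\<^sub>R u i" by blast
    define W where "W = {v. \<forall>i\<in>F. cip (u i) v = 0}"
    have "subspace W"
      by (auto simp: W_def subspace_def cip_add_right cip_scaleR_right) (simp add: cip_def)
    moreover have "A *v v \<in> W" if "v \<in> W" for v
    proof -
      have "cip (u i) (A *v v) = 0" if "i \<in> F" for i
      proof -
        have "cip (u i) (A *v v) = cip (A *v u i) v"
          by (simp add: cip_matrix_adj assms)
        also have "\<dots> = cnj (cip v (c i *\<^sub>R u i))"
          using c that by (metis cip_cnj)
        also have "\<dots> = c i *\<^sub>R cip (u i) v"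
          by (simp add: cip_scaleR_right cip_cnj[of v])
        finally show ?thesis
          using that \<open>v \<in> W\<close> by (simp add: W_def)
      qed
      then show ?thesis by (simp add: W_def)
    qed
    moreover obtain v0 where "v0 \<in> W" "v0 \<noteq> 0"
      using exists_orthogonal_vector[of F u] insert.hyps by (auto simp: W_def)
    ultimately obtain w d where w: "w \<in> W" "norm w = 1" "A *v w = d *\<^sub>R w"
      using exists_eigenvector_in_subspace[OF assms] by blast
    have "cip w w = 1" using w by (simp add: cip_self)
    moreover have "cip (u i) w = 0" "cip w (u i) = 0" if "i \<in> F" for i
      using w that by (auto simp: W_def cip_cnj[of w])
    ultimately show ?case
      using u c w(3) insert.hyps
      by (intro exI[of _ "u(x := w)"] exI[of _ "c(x := d)"]) auto
  qed
  from this[OF finite_class.finite_UNIV] obtain u :: "'n \<Rightarrow> complex^'n" and c where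
    u: "\<And>i j. cip (u i) (u j) = (if i = j then 1 else 0)" and c: "\<And>i. A *v u i = c i *\<^sub>R u i"
    by auto
  define U where "U = (\<chi> i j. u j $ i)"
  have "adj U ** U = mat 1"
    using u by (simp add: vec_eq_iff U_def matrix_matrix_mult_def mat_def cip_def)
  moreover have "A ** U = U ** diag_mat c"
    using c by (simp add: vec_eq_iff) (simp add: U_def matrix_matrix_mult_def matrix_vector_mult_def scaleR_conv_of_real mult_ac)
  then have "adj U ** A ** U = diag_mat c"
    by (metis calculation matrix_mul_assoc matrix_mul_lid)
  ultimately show ?thesis
    unfolding eigenbasis_def by blast
qed

lemma eigenbasis_some_eigenbasis:
  fixes A :: "complex^'n^'n"
  assumes "adj A = A"
  shows "eigenbasis A (fst (some_eigenbasis A)) (snd (some_eigenbasis A))"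
proof -
  obtain U s where "eigenbasis A U s"
    using hermitian_eigenbasis_exists[OF assms] by blast
  then have "case (U, s) of (U, s) \<Rightarrow> eigenbasis A U s" by simp
  then have "case some_eigenbasis A of (U, s) \<Rightarrow> eigenbasis A U s"
    unfolding some_eigenbasis_def by (rule someI)
  then show ?thesis by (simp add: split_beta)
qed

section \<open>Positive semidefinite matrices\<close>

lemma psd_mats_iff:
  "A \<in> psd_mats \<longleftrightarrow> adj A = A \<and> (\<forall>v. 0 \<le> Re (cip v (A *v v)))"
proof -
  have "(\<Sum>i\<in>UNIV. \<Sum>j\<in>UNIV. cnj (v i) * A $ i $ j * v j) = cip (vec_lambda v) (A *v vec_lambda v)" for v
    by (simp add: cip_def matrix_vector_mult_def sum_distrib_left mult_ac)
  moreover have "(\<forall>v. 0 \<le> Re (cip (vec_lambda v) (A *v vec_lambda v))) \<longleftrightarrow> (\<forall>v. 0 \<le> Re (cip v (A *v v)))"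
    by (metis vec_nth_inverse)
  moreover have "hermitian_on UNIV (\<lambda>i j. A $ i $ j) \<longleftrightarrow> adj A = A"
    using hermitian_mats_iff[of A] by (simp add: hermitian_mats_def)
  ultimately show ?thesis
    unfolding psd_mats_def psd_on_def mem_Collect_eq by (simp only:)
qed

lemma congruence_nth_cip: "(adj V ** A ** V) $ j $ k = cip (column j V) (A *v column k V)"
  unfolding matrix_mul_assoc[symmetric]
  by (simp add: cip_def column_def matrix_matrix_mult_def matrix_vector_mult_def)

lemma psd_mats_congruence_diag:
  "A \<in> psd_mats \<Longrightarrow> 0 \<le> Re ((adj V ** A ** V) $ j $ j)"
  by (simp add: psd_mats_iff congruence_nth_cip)

text \<open>The \<open>k\<close>-th column of \<open>U\<close> is a unit vector at which the form of
  \<open>A\<close> has the value \<open>s k\<close>.\<close>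

lemma eigenbasis_ge:
  fixes A :: "complex^'n^'n"
  assumes "eigenbasis A U s" and "\<And>v. c * (norm v)\<^sup>2 \<le> Re (cip v (A *v v))"
  shows "c \<le> s k"
proof -
  have "cip (column k U) (column k U) = (adj U ** mat 1 ** U) $ k $ k"
    by (simp only: congruence_nth_cip matrix_vector_mul_lid)
  then have "complex_of_real ((norm (column k U))\<^sup>2) = 1"
    using eigenbasisD(1)[OF assms(1)] unfolding cip_self by (simp only: matrix_mul_rid) (simp add: mat_def)
  then have "(norm (column k U))\<^sup>2 = 1"
    by (simp only: of_real_eq_1_iff)
  then have "norm (column k U) = 1"
    by (simp add: power2_eq_1_iff) (metis norm_ge_zero not_one_le_zero neg_0_le_iff_le)
  moreover have "cip (column k U) (A *v column k U) = s k"
    using assms(1) unfolding congruence_nth_cip[symmetric] by (simp add: eigenbasis_def diag_mat_def)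
  ultimately show ?thesis
    using assms(2)[of "column k U"] by simp
qed

lemma psd_mats_eigenbasis_nonneg:
  "A \<in> psd_mats \<Longrightarrow> eigenbasis A U s \<Longrightarrow> 0 \<le> s k"
  by (rule eigenbasis_ge) (auto simp: psd_mats_iff)

lemma matrix_mul_column: "A *v column k U = column k (A ** U)"
  by (simp add: vec_eq_iff column_def matrix_matrix_mult_def matrix_vector_mult_def)

lemma eigenbasis_mul:
  fixes A :: "complex^'n^'n"
  assumes "eigenbasis A U s" shows "A ** U = U ** diag_mat s"
  using eigenbasisD[OF assms] by (metis matrix_mul_assoc matrix_mul_rid)

lemma congruence_eq_0_of_kernel:
  fixes A R :: "complex^'n^'n"
  assumes "eigenbasis A U s" and "\<And>x. A *v x = 0 \<Longrightarrow> R *v x = 0" and "s k = 0"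
  shows "(adj U ** R ** U) $ l $ k = 0"
proof -
  have "A *v column k U = 0"
    using assms(3) unfolding matrix_mul_column eigenbasis_mul[OF assms(1)]
    by (simp add: vec_eq_iff column_def)
  then have "R *v column k U = 0"
    by (rule assms(2))
  then show ?thesis
    by (simp add: congruence_nth_cip cip_def)
qed

lemma trace_mul_conj_diag:
  "trace (R ** (U ** diag_mat t ** adj U)) = (\<Sum>k\<in>UNIV. (adj U ** R ** U) $ k $ k * of_real (t k))"
proof -
  have "trace (R ** (U ** diag_mat t ** adj U)) = trace ((R ** U ** diag_mat t) ** adj U)"
    by (simp add: matrix_mul_assoc)
  also have "\<dots> = trace ((adj U ** R ** U) ** diag_mat t)"
    by (subst trace_mul_sym) (simp add: matrix_mul_assoc)
  finally show ?thesis
    by (simp add: trace_def)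
qed

lemma Re_mult_of_real: "Re (z * of_real x) = Re z * x"
  by simp

lemma trace_mul_conj_diag2:
  fixes R :: "complex^'n^'n"
  shows "trace (R ** (U ** diag_mat t ** adj U) ** Z ** (U ** diag_mat t ** adj U)) =
    (\<Sum>k\<in>UNIV. \<Sum>l\<in>UNIV. (adj U ** R ** U) $ k $ l * (adj U ** Z ** U) $ l $ k *
       of_real (t k * t l))"
proof -
  have "trace (R ** (U ** diag_mat t ** adj U) ** Z ** (U ** diag_mat t ** adj U)) =
    trace ((R ** (U ** diag_mat t ** adj U) ** Z ** U ** diag_mat t) ** adj U)"
    by (simp add: matrix_mul_assoc)
  also have "\<dots> = trace ((adj U ** R ** U ** diag_mat t) ** (adj U ** Z ** U ** diag_mat t))"
    by (subst trace_mul_sym) (simp add: matrix_mul_assoc)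
  finally show ?thesis
    by (simp add: trace_matrix_mul mult_ac)
qed

section \<open>Divided differences of the logarithm\<close>

text \<open>At positive definite matrices, entrywise multiplication by
  \<open>ln_dd (s k) (s l)\<close> in an eigenbasis is the derivative of the matrix logarithm. The
  value at \<open>a = b\<close> is the continuous extension.\<close>

definition ln_dd :: "real \<Rightarrow> real \<Rightarrow> real" where
  "ln_dd a b = (if a = b then 1 / a else (ln a - ln b) / (a - b))"

text \<open>The differential form of the integral representation of the divided difference:
  \<open>ln_dd a b\<close> is the integral over x > 0 of the product of the resolvents 1/(a + x) and
  1/(b + x).\<close>

lemma has_real_derivative_ln_dd:
  assumes "a + x > 0" "b + x > 0"
  shows "((\<lambda>x. ln_dd (a + x) (b + x)) has_real_derivative - (1 / ((a + x) * (b + x)))) (at x)"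
proof (cases "a = b")
  case True
  have "((\<lambda>x. 1 / (a + x)) has_real_derivative - (1 / ((a + x) * (a + x)))) (at x)"
    using assms(1) by (auto intro!: derivative_eq_intros)
  then show ?thesis using True by (simp add: ln_dd_def)
next
  case False
  have "((\<lambda>x. (ln (a + x) - ln (b + x)) / (a - b)) has_real_derivative
      (1 / (a + x) - 1 / (b + x)) / (a - b)) (at x)"
    using False assms by (auto intro!: derivative_eq_intros)
  moreover have "(1 / (a + x) - 1 / (b + x)) / (a - b) = - (1 / ((a + x) * (b + x)))"
  proof -
    have "1 / (a + x) - 1 / (b + x) = (b - a) / ((a + x) * (b + x))"
      using assms by (subst diff_frac_eq) (auto simp: algebra_simps)
    moreover have "(b - a) / (a - b) = - 1"
      using False by (simp add: field_simps)
    ultimately show ?thesis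
      by (metis (no_types, lifting) divide_divide_eq_left divide_minus_left mult.commute)
  qed
  ultimately show ?thesis using False by (simp add: ln_dd_def)
qed

lemma tendsto_ln_diff_at_top:
  "((\<lambda>x::real. ln (a + x) - ln x) \<longlongrightarrow> 0) at_top"
proof -
  have "((\<lambda>x::real. a / x) \<longlongrightarrow> 0) at_top"
    by (intro tendsto_divide_0[OF tendsto_const] filterlim_at_top_imp_at_infinity filterlim_ident)
  then have "((\<lambda>x::real. ln (1 + a / x)) \<longlongrightarrow> ln (1 + 0)) at_top"
    by (intro tendsto_intros) auto
  moreover have "\<forall>\<^sub>F x in at_top. ln (1 + a / x) = ln (a + x) - ln x"
    using eventually_gt_at_top[of "max 0 (-a)"]
  proof eventually_elim
    case (elim x)
    then have "1 + a / x = (a + x) / x" by (simp add: field_simps)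
    then show ?case using elim by (simp add: ln_div)
  qed
  ultimately show ?thesis
    by (simp add: tendsto_cong)
qed

lemma tendsto_ln_dd_at_top: "((\<lambda>x. ln_dd (a + x) (b + x)) \<longlongrightarrow> 0) at_top"
proof (cases "a = b")
  case True
  have "((\<lambda>x::real. 1 / (a + x)) \<longlongrightarrow> 0) at_top"
    by (intro tendsto_divide_0[OF tendsto_const] filterlim_at_top_imp_at_infinity
        filterlim_tendsto_add_at_top[OF tendsto_const] filterlim_ident)
  then show ?thesis using True by (simp add: ln_dd_def)
next
  case False
  have "((\<lambda>x. ((ln (a + x) - ln x) - (ln (b + x) - ln x)) / (a - b)) \<longlongrightarrow> (0 - 0) / (a - b)) at_top"
    using False by (intro tendsto_intros tendsto_ln_diff_at_top) auto
  then show ?thesis using False by (simp add: ln_dd_def)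
qed

lemma tendsto_x_ln_x_at_right_0: "((\<lambda>x::real. x * ln x) \<longlongrightarrow> 0) (at_right 0)"
proof -
  have "((\<lambda>x::real. - (ln (inverse x) / inverse x)) \<longlongrightarrow> - 0) (at_right 0)"
    by (intro tendsto_minus filterlim_compose[OF ln_x_over_x_tendsto_0] filterlim_inverse_at_top_right)
  moreover have "\<forall>\<^sub>F x::real in at_right 0. - (ln (inverse x) / inverse x) = x * ln x"
    using eventually_at_right_less[of 0] by eventually_elim (simp add: ln_inverse divide_inverse)
  ultimately show ?thesis by (simp add: tendsto_cong)
qed

text \<open>As \<open>t\<close> tends to 0, \<open>ln_dd (c * t) m\<close> grows only like the
  logarithm of 1/t, which the factor \<open>t\<close> outweighs.\<close>

lemma tendsto_mult_ln_dd_at_right_0: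
  assumes "0 < c" "0 < m"
  shows "((\<lambda>t. t * ln_dd (c * t) m) \<longlongrightarrow> 0) (at_right 0)"
proof -
  have "((\<lambda>t::real. (t * ln c + t * ln t - t * ln m) / (c * t - m)) \<longlongrightarrow>
      (0 * ln c + 0 - 0 * ln m) / (c * 0 - m)) (at_right 0)"
    using assms by (intro tendsto_intros tendsto_ident_at tendsto_x_ln_x_at_right_0) auto
  moreover have "\<forall>\<^sub>F t in at_right 0. (t * ln c + t * ln t - t * ln m) / (c * t - m) = t * ln_dd (c * t) m"
    \<comment> \<open>For \<open>t < m / c\<close> the arguments \<open>c * t\<close> and
      \<open>m\<close> differ, so \<open>ln_dd\<close> is a genuine quotient.\<close>
    using eventually_at_right_real[of 0 "m / c"] assms
    by (auto elim!: eventually_mono simp: ln_dd_def ln_mult field_simps)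
  ultimately show ?thesis
    by (simp add: tendsto_cong)
qed

text \<open>Stands in for integrating the derivative from 0 to infinity. Only continuity is asked
  for at 0, where resolvents of a singular matrix do not exist.\<close>

lemma nonpos_of_deriv_nonneg_tendsto_0:
  fixes f :: "real \<Rightarrow> real"
  assumes "\<And>x. 0 < x \<Longrightarrow> (f has_real_derivative f' x) (at x)"
    and "\<And>x. 0 < x \<Longrightarrow> 0 \<le> f' x" and "continuous_on {0..} f" and "(f \<longlongrightarrow> 0) at_top"
  shows "f 0 \<le> 0"
proof (rule tendsto_lowerbound[OF assms(4)])
  show "\<forall>\<^sub>F x in at_top. f 0 \<le> f x"
    using eventually_gt_at_top[of 0]
  proof eventually_elim
    case (elim x)
    show ?case
    proof (rule DERIV_nonneg_imp_increasing_open[where f = f])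
      show "continuous_on {0..x} f"
        by (rule continuous_on_subset[OF assms(3)]) auto
    qed (use elim assms in auto)
  qed
qed simp

section \<open>The logarithm under a perturbation\<close>

definition log_in_basis :: "complex^'n^'n \<Rightarrow> ('n \<Rightarrow> real) \<Rightarrow> complex^'n^'n" where
  "log_in_basis U s = U ** diag_mat (\<lambda>k. if s k > 0 then ln (s k) else 0) ** adj U"

text \<open>The operator \<open>L\<^sub>\<sigma>\<close> for \<sigma> with the given eigenbasis and
  eigenvalues.\<close>

definition L_in_basis :: "complex^'n^'n \<Rightarrow> ('n \<Rightarrow> real) \<Rightarrow> complex^'n^'n \<Rightarrow> complex^'n^'n" where
  "L_in_basis U s R = U ** (\<chi> k l. if s k > 0 \<and> s l > 0
     then (adj U ** R ** U) $ k $ l * of_real (ln_dd (s k) (s l)) else 0) ** adj U"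

text \<open>For unitary \<open>U\<close>, an upper bound for the modulus of the trace of
  \<open>R ** Z\<close> that remains valid when the terms receive weights between 0 and 1, whatever
  their signs.\<close>

definition entry_pairing :: "complex^'n^'n \<Rightarrow> complex^'n^'n \<Rightarrow> complex^'n^'n \<Rightarrow> real" where
  "entry_pairing U R Z =
    (\<Sum>k\<in>UNIV. \<Sum>l\<in>UNIV. cmod ((adj U ** R ** U) $ k $ l * (adj U ** Z ** U) $ l $ k))"

text \<open>\<open>S\<close> is the base point and \<open>A\<close> the perturbed point; both may be
  singular. The kernel conditions give \<open>R\<close> no weight on eigenvectors with eigenvalue 0,
  where the logarithm diverges.\<close>

locale log_perturbation =
  fixes S A R U V :: "complex^'n^'n" and s a :: "'n \<Rightarrow> real"
  assumes eigS: "eigenbasis S U s" and eigA: "eigenbasis A V a"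
    and s_nonneg: "0 \<le> s k" and a_nonneg: "0 \<le> a k"
    and S_herm: "adj S = S" and A_herm: "adj A = A" and R_psd: "R \<in> psd_mats"
    and kerS: "S *v x = 0 \<Longrightarrow> R *v x = 0" and kerA: "A *v x = 0 \<Longrightarrow> R *v x = 0"
begin

section \<open>The linearization error and its behavior at 0 and infinity\<close>

definition Y where "Y = A - S"
definition w where "w j = Re ((adj V ** R ** V) $ j $ j)"
definition r where "r k = Re ((adj U ** R ** U) $ k $ k)"
definition c where "c k l = Re ((adj U ** R ** U) $ k $ l * (adj U ** Y ** U) $ l $ k)"

text \<open>
  The error at \<open>x\<close> of the first-order expansion of \<open>Tr R log(A + x)\<close> around \<open>S + x\<close>; the terms
  with \<open>s k = 0\<close> or \<open>a j = 0\<close> have vanishing coefficients, which makes \<open>x = 0\<close> admissible.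
\<close>

definition log_gap :: "real \<Rightarrow> real" where
  "log_gap x = (\<Sum>j\<in>UNIV. w j * ln (a j + x)) - (\<Sum>k\<in>UNIV. r k * ln (s k + x)) -
     (\<Sum>k\<in>UNIV. \<Sum>l\<in>UNIV. c k l * ln_dd (s k + x) (s l + x))"

text \<open>The inverses of \<open>S + x\<close> and \<open>A + x\<close> for \<open>x > 0\<close>,
  in spectral form.\<close>

definition resS where "resS x = U ** diag_mat (\<lambda>k. 1 / (s k + x)) ** adj U"
definition resA where "resA x = V ** diag_mat (\<lambda>k. 1 / (a k + x)) ** adj V"

text \<open>The part of \<open>resA x\<close> beyond first order in \<open>Y\<close>, paired with
  \<open>R\<close>; it turns out to be the derivative of \<open>log_gap\<close>.\<close>

definition log_gap' :: "real \<Rightarrow> real" where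
  "log_gap' x = Re (trace (R ** (resS x ** Y ** resA x ** Y ** resS x)))"

lemma R_herm: "adj R = R"
  using R_psd by (simp add: psd_mats_iff)

lemma Y_herm: "adj Y = Y"
  by (simp add: Y_def adj_diff S_herm A_herm)

lemma w_eq_0: "a j = 0 \<Longrightarrow> w j = 0"
  unfolding w_def by (subst congruence_eq_0_of_kernel[OF eigA kerA]) auto

lemma R_entry_eq_0:
  assumes "s k = 0 \<or> s l = 0" shows "(adj U ** R ** U) $ k $ l = 0"
proof -
  have "adj (adj U ** R ** U) = adj U ** R ** U"
    by (simp add: adj_matrix_mul R_herm matrix_mul_assoc)
  then have "(adj U ** R ** U) $ k $ l = cnj ((adj U ** R ** U) $ l $ k)"
    by (metis adj_nth)
  then show ?thesis
    using assms congruence_eq_0_of_kernel[OF eigS kerS] by auto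
qed

lemma r_eq_0: "s k = 0 \<Longrightarrow> r k = 0"
  by (simp add: r_def R_entry_eq_0)

lemma c_eq_0: "s k = 0 \<or> s l = 0 \<Longrightarrow> c k l = 0"
  unfolding c_def by (subst R_entry_eq_0) auto

lemma sum_w_eq_sum_r: "sum w UNIV = sum r UNIV"
proof -
  have "sum w UNIV = Re (trace (adj V ** R ** V))" "sum r UNIV = Re (trace (adj U ** R ** U))"
    by (simp_all add: w_def r_def trace_def)
  then show ?thesis
    by (simp add: trace_unitary_conj eigenbasisD(1)[OF eigS] eigenbasisD(1)[OF eigA])
qed

text \<open>Terms with a zero eigenvalue have coefficient 0, so the value of \<open>ln\<close> at 0
  never enters and the sums agree with the logarithms cut off to the supports.\<close>

lemma log_gap_0:
  "log_gap 0 = Re (trace (R ** log_in_basis V a)) - Re (trace (R ** log_in_basis U s)) -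
     Re (trace (L_in_basis U s R ** Y))"
proof -
  have "(\<Sum>j\<in>UNIV. w j * ln (a j + 0)) = Re (trace (R ** log_in_basis V a))"
    unfolding log_in_basis_def trace_mul_conj_diag
    using a_nonneg w_eq_0 by (auto simp: w_def less_le intro!: sum.cong)
  moreover have "(\<Sum>k\<in>UNIV. r k * ln (s k + 0)) = Re (trace (R ** log_in_basis U s))"
    unfolding log_in_basis_def trace_mul_conj_diag
    using s_nonneg r_eq_0 by (auto simp: r_def less_le intro!: sum.cong)
  moreover have "(\<Sum>k\<in>UNIV. \<Sum>l\<in>UNIV. c k l * ln_dd (s k + 0) (s l + 0)) =
      Re (trace (L_in_basis U s R ** Y))"
  proof -
    let ?M = "\<chi> k l. if s k > 0 \<and> s l > 0
       then (adj U ** R ** U) $ k $ l * of_real (ln_dd (s k) (s l)) else 0"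
    have "trace (L_in_basis U s R ** Y) = trace (U ** (?M ** adj U ** Y))"
      by (simp add: L_in_basis_def matrix_mul_assoc)
    also have "\<dots> = trace (?M ** (adj U ** Y ** U))"
      by (subst trace_mul_sym) (simp add: matrix_mul_assoc)
    also have "Re \<dots> = (\<Sum>k\<in>UNIV. \<Sum>l\<in>UNIV. c k l * ln_dd (s k + 0) (s l + 0))"
      unfolding trace_matrix_mul Re_sum
    proof (intro sum.cong refl)
      fix k l
      show "Re (?M $ k $ l * (adj U ** Y ** U) $ l $ k) = c k l * ln_dd (s k + 0) (s l + 0)"
      proof (cases "s k > 0 \<and> s l > 0")
        case True
        then show ?thesis by (simp add: c_def algebra_simps)
      next
        case False
        then have "c k l = 0"
          using s_nonneg[of k] s_nonneg[of l] c_eq_0[of k l] by linarith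
        then show ?thesis using False by auto
      qed
    qed
    finally show ?thesis by simp
  qed
  ultimately show ?thesis by (simp add: log_gap_def)
qed

lemma log_gap_tendsto_0: "(log_gap \<longlongrightarrow> 0) at_top"
proof -
  \<comment> \<open>Each logarithmic sum diverges at infinity. Both weight families add up to the
    trace of \<open>R\<close>, so \<open>ln x\<close> can be subtracted from every
    logarithm.\<close>
  have "log_gap = (\<lambda>x. (\<Sum>j\<in>UNIV. w j * (ln (a j + x) - ln x)) - (\<Sum>k\<in>UNIV. r k * (ln (s k + x) - ln x)) -
     (\<Sum>k\<in>UNIV. \<Sum>l\<in>UNIV. c k l * ln_dd (s k + x) (s l + x)))"
    using sum_w_eq_sum_r
    by (rule_tac ext) (simp add: log_gap_def right_diff_distrib sum_subtractf sum_distrib_right[symmetric])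
  moreover have "((\<lambda>x. (\<Sum>j\<in>UNIV. w j * (ln (a j + x) - ln x)) - (\<Sum>k\<in>UNIV. r k * (ln (s k + x) - ln x)) -
     (\<Sum>k\<in>UNIV. \<Sum>l\<in>UNIV. c k l * ln_dd (s k + x) (s l + x))) \<longlongrightarrow>
     (\<Sum>j\<in>UNIV. w j * 0) - (\<Sum>k\<in>UNIV. r k * 0) - (\<Sum>k\<in>UNIV. \<Sum>l\<in>UNIV. c k l * 0)) at_top"
    by (intro tendsto_intros tendsto_ln_diff_at_top tendsto_ln_dd_at_top)
  ultimately show ?thesis by simp
qed

lemma continuous_on_log_gap: "continuous_on {0..} log_gap"
proof -
  have ln: "continuous_on {0..} (\<lambda>x. p * ln (q + x))" if "0 \<le> q" "q = 0 \<Longrightarrow> p = 0" for p q :: real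
    using that by (cases "q = 0") (auto intro!: continuous_intros)
  have "continuous_on {0..} (\<lambda>x. c k l * ln_dd (s k + x) (s l + x))" for k l
  proof (cases "s k = 0 \<or> s l = 0")
    case True
    then show ?thesis using c_eq_0 by auto
  next
    case False
    then have "s k > 0" "s l > 0"
      using s_nonneg[of k] s_nonneg[of l] by auto
    then have "isCont (\<lambda>x. ln_dd (s k + x) (s l + x)) x" if "0 \<le> x" for x
      using that by (intro DERIV_isCont[OF has_real_derivative_ln_dd]) auto
    then show ?thesis
      by (intro continuous_intros continuous_at_imp_continuous_on) auto
  qed
  then show ?thesis
    unfolding log_gap_def
    by (intro continuous_on_diff continuous_on_sum ln)
      (auto simp: s_nonneg a_nonneg w_eq_0 r_eq_0)
qed

section \<open>Resolvents and two-sided bounds on the error\<close>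

lemma resS_herm: "adj (resS x) = resS x"
  by (simp add: resS_def adj_matrix_mul matrix_mul_assoc)

text \<open>One form of the first-order resolvent identity is substituted into the other. The exact
  remainder is \<open>resA x\<close> between \<open>resS x ** Y\<close> and its adjoint, hence
  positive semidefinite.\<close>

lemma resolvent_expansion:
  assumes "0 < x"
  shows "resA x - resS x + resS x ** Y ** resS x = resS x ** Y ** resA x ** Y ** resS x"
proof -
  \<comment> \<open>Adding \<open>x\<close> times the identity shifts the eigenvalues and keeps the
    eigenbasis.\<close>
  have shift: "M = W ** diag_mat (\<lambda>k. m k + x) ** adj W"
    if "eigenbasis B W m" "M = B + diag_mat (\<lambda>k. x)" for B W M :: "complex^'n^'n" and m
  proof -
    have "diag_mat (\<lambda>k. m k + x) = diag_mat m + (diag_mat (\<lambda>k. x) :: complex^'n^'n)"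
      by (simp add: vec_eq_iff diag_mat_def)
    moreover have "W ** diag_mat (\<lambda>k. x) ** adj W = diag_mat (\<lambda>k. x) ** (W ** adj W)"
      unfolding matrix_mul_assoc by (rule arg_cong[where f = "\<lambda>Z. Z ** adj W"]) (simp add: vec_eq_iff mult.commute)
    ultimately show ?thesis
      using that eigenbasisD(2,3)[OF that(1)]
      by (simp add: matrix_add_ldistrib matrix_add_rdistrib)
  qed
  have inv: "M ** (W ** diag_mat (\<lambda>k. 1 / (m k + x)) ** adj W) = mat 1 \<and>
     (W ** diag_mat (\<lambda>k. 1 / (m k + x)) ** adj W) ** M = mat 1"
    if e: "eigenbasis B W m" and M: "M = B + diag_mat (\<lambda>k. x)" and m: "\<And>k. 0 \<le> m k"
    for B W M :: "complex^'n^'n" and m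
  proof -
    have "0 < m k + x" for k using m[of k] assms by simp
    then have "m k + x \<noteq> 0" for k by (metis less_irrefl)
    then have "diag_mat (\<lambda>k. m k + x) ** diag_mat (\<lambda>k. 1 / (m k + x)) = (mat 1 :: complex^'n^'n)"
      by (simp add: diag_mat_mul_diag_mat diag_mat_1)
    moreover have "M ** (W ** diag_mat (\<lambda>k. 1 / (m k + x)) ** adj W) =
      W ** (diag_mat (\<lambda>k. m k + x) ** ((adj W ** W) ** diag_mat (\<lambda>k. 1 / (m k + x)))) ** adj W"
      unfolding shift[OF e M] by (simp only: matrix_mul_assoc)
    ultimately have "M ** (W ** diag_mat (\<lambda>k. 1 / (m k + x)) ** adj W) = mat 1"
      by (simp add: eigenbasisD(1,2)[OF e])
    then show ?thesis by (simp add: matrix_left_right_inverse)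
  qed
  define S' where "S' = S + diag_mat (\<lambda>k. x)"
  define A' where "A' = A + diag_mat (\<lambda>k. x)"
  have S1: "S' ** resS x = mat 1" "resS x ** S' = mat 1"
    using inv[OF eigS S'_def s_nonneg] by (auto simp: resS_def)
  have A1: "A' ** resA x = mat 1" "resA x ** A' = mat 1"
    using inv[OF eigA A'_def a_nonneg] by (auto simp: resA_def)
  have Y: "Y = A' - S'"
    by (simp add: Y_def S'_def A'_def)
  have 1: "resS x ** Y ** resA x = resS x - resA x"
    unfolding Y matrix_mul_diff_ldistrib matrix_mul_diff_rdistrib
    by (simp add: S1 A1 matrix_mul_assoc[symmetric])
  have 2: "resA x ** Y ** resS x = resS x - resA x"
    unfolding Y matrix_mul_diff_ldistrib matrix_mul_diff_rdistrib
    by (simp add: S1 A1) (simp add: S1 A1 matrix_mul_assoc[symmetric])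
  have "resS x ** Y ** resA x ** Y ** resS x = resS x ** Y ** (resA x ** Y ** resS x)"
    by (simp add: matrix_mul_assoc)
  also have "\<dots> = resS x ** Y ** resS x - resS x ** Y ** resA x"
    unfolding 2 by (rule matrix_mul_diff_ldistrib)
  finally show ?thesis
    using 1 by simp
qed

text \<open>The termwise derivative is the trace of \<open>R\<close> against the left side of
  \<open>resolvent_expansion\<close>.\<close>

lemma log_gap_has_derivative:
  assumes "0 < x"
  shows "(log_gap has_real_derivative log_gap' x) (at x)"
proof -
  have pos: "s k + x > 0" "a k + x > 0" for k
    using s_nonneg[of k] a_nonneg[of k] assms by auto
  have "(log_gap has_real_derivative
     (\<Sum>j\<in>UNIV. w j * (1 / (a j + x))) - (\<Sum>k\<in>UNIV. r k * (1 / (s k + x))) -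
     (\<Sum>k\<in>UNIV. \<Sum>l\<in>UNIV. c k l * - (1 / ((s k + x) * (s l + x))))) (at x)"
    unfolding log_gap_def
    using pos by (intro DERIV_diff DERIV_sum DERIV_cmult has_real_derivative_ln_dd)
      (auto intro!: derivative_eq_intros)
  moreover have "(\<Sum>j\<in>UNIV. w j * (1 / (a j + x))) = Re (trace (R ** resA x))"
    by (simp add: resA_def trace_mul_conj_diag w_def)
  moreover have "(\<Sum>k\<in>UNIV. r k * (1 / (s k + x))) = Re (trace (R ** resS x))"
    by (simp add: resS_def trace_mul_conj_diag r_def)
  moreover have "(\<Sum>k\<in>UNIV. \<Sum>l\<in>UNIV. c k l * - (1 / ((s k + x) * (s l + x)))) =
     - Re (trace (R ** (resS x ** Y ** resS x)))"
    by (simp add: resS_def matrix_mul_assoc[of R] trace_mul_conj_diag2[unfolded matrix_mul_assoc] matrix_mul_assoc)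
      (simp add: c_def sum_negf Re_divide_of_real del: of_real_mult of_real_add)
  moreover have "log_gap' x = Re (trace (R ** resA x)) - Re (trace (R ** resS x)) +
     Re (trace (R ** (resS x ** Y ** resS x)))"
    unfolding log_gap'_def resolvent_expansion[OF assms, symmetric]
    by (simp add: matrix_add_ldistrib matrix_mul_diff_ldistrib trace_add trace_sub)
  ultimately show ?thesis by simp
qed

text \<open>Diagonalizing the inner resolvent \<open>resA x\<close> leaves a congruence of
  \<open>R\<close>. Its diagonal entries are nonnegative, and the eigenvalues of \<open>A\<close>
  enter only as positive weights.\<close>

lemma log_gap'_eq:
  "log_gap' x = (\<Sum>j\<in>UNIV. Re ((adj (resS x ** Y ** V) ** R ** (resS x ** Y ** V)) $ j $ j) / (a j + x))"
proof -
  let ?N = "resS x ** Y ** V" and ?D = "diag_mat (\<lambda>k. 1 / (a k + x)) :: complex^'n^'n"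
  have "resS x ** Y ** resA x ** Y ** resS x = ?N ** ?D ** adj ?N"
    by (simp add: resA_def adj_matrix_mul Y_herm resS_herm matrix_mul_assoc)
  then show ?thesis
    by (simp add: log_gap'_def trace_mul_conj_diag)
qed

text \<open>A first-order form of the concavity of Tr R log A in A that admits singular
  \<open>S\<close> and \<open>A\<close>.\<close>

theorem log_gap_nonpos: "log_gap 0 \<le> 0"
proof (rule nonpos_of_deriv_nonneg_tendsto_0)
  show "0 \<le> log_gap' x" if "0 < x" for x
    unfolding log_gap'_eq using that a_nonneg psd_mats_congruence_diag[OF R_psd]
    by (intro sum_nonneg divide_nonneg_nonneg add_nonneg_nonneg) auto
qed (fact log_gap_has_derivative continuous_on_log_gap log_gap_tendsto_0)+

text \<open>Replacing every \<open>a j\<close> by its lower bound \<open>\<alpha>\<close> removes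
  the basis \<open>V\<close>. What remains is a trace in which \<open>R\<close> sees only
  eigenvalues of \<open>S\<close> that are at least \<open>m\<close>. The bound has the shape of a
  multiple of the derivative of \<open>ln_dd (\<alpha> + x) (m + x)\<close>.\<close>

lemma log_gap'_le:
  assumes x: "0 < x" and "0 < \<alpha>" "\<And>j. \<alpha> \<le> a j" and m: "0 < m" "\<And>k. 0 < s k \<Longrightarrow> m \<le> s k"
  shows "log_gap' x \<le> entry_pairing U R (Y ** Y) / m * (1 / ((\<alpha> + x) * (m + x)))"
proof -
  let ?N = "resS x ** Y ** V"
  let ?P = "\<lambda>k l. (adj U ** R ** U) $ k $ l * (adj U ** (Y ** Y) ** U) $ l $ k"
  let ?t = "\<lambda>k. 1 / (s k + x)"
  have "?N ** adj ?N = resS x ** Y ** (V ** adj V) ** Y ** resS x"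
    by (simp add: adj_matrix_mul Y_herm resS_herm matrix_mul_assoc)
  then have NN: "?N ** adj ?N = resS x ** (Y ** Y) ** resS x"
    by (simp add: eigenbasisD(2)[OF eigA] matrix_mul_assoc)
  have "(\<Sum>j\<in>UNIV. Re ((adj ?N ** R ** ?N) $ j $ j)) = Re (trace (adj ?N ** (R ** ?N)))"
    by (simp add: trace_def matrix_mul_assoc)
  also have "\<dots> = Re (trace (R ** (?N ** adj ?N)))"
    by (subst trace_mul_sym) (simp add: matrix_mul_assoc)
  also have "\<dots> = Re (trace (R ** resS x ** (Y ** Y) ** resS x))"
    unfolding NN by (simp add: matrix_mul_assoc)
  also have "\<dots> = (\<Sum>k\<in>UNIV. \<Sum>l\<in>UNIV. Re (?P k l) * (?t k * ?t l))"
    unfolding resS_def trace_mul_conj_diag2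
    by (simp only: Re_sum Re_mult_of_real)
  also have "\<dots> \<le> (\<Sum>k\<in>UNIV. \<Sum>l\<in>UNIV. cmod (?P k l) * (1 / (m * (m + x))))"
  proof (intro sum_mono)
    fix k l
    show "Re (?P k l) * (?t k * ?t l) \<le> cmod (?P k l) * (1 / (m * (m + x)))"
    proof (cases "s k = 0 \<or> s l = 0")
      case True
      then show ?thesis using R_entry_eq_0[of k l] by simp
    next
      case False
      then have "m \<le> s k" "m \<le> s l"
        using s_nonneg[of k] s_nonneg[of l] m(2) by auto
      \<comment> \<open>One factor is estimated by the constant \<open>1 / m\<close>, so that,
        together with \<open>1 / (\<alpha> + x)\<close>, exactly two linear denominators
        remain.\<close>
      then have "?t k * ?t l \<le> 1 / m * (1 / (m + x))"
        using m x by (intro mult_mono) (auto simp: frac_le)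
      moreover have "0 \<le> ?t k * ?t l"
        using s_nonneg[of k] s_nonneg[of l] x by simp
      ultimately show ?thesis
        by (intro mult_mono complex_Re_le_cmod) auto
    qed
  qed
  also have "\<dots> = entry_pairing U R (Y ** Y) * (1 / (m * (m + x)))"
    by (simp add: entry_pairing_def sum_divide_distrib)
  finally have bound: "(\<Sum>j\<in>UNIV. Re ((adj ?N ** R ** ?N) $ j $ j)) \<le>
     entry_pairing U R (Y ** Y) * (1 / (m * (m + x)))" .
  have "log_gap' x \<le> (\<Sum>j\<in>UNIV. Re ((adj ?N ** R ** ?N) $ j $ j) / (\<alpha> + x))"
    unfolding log_gap'_eq using assms psd_mats_congruence_diag[OF R_psd]
    by (intro sum_mono divide_left_mono mult_pos_pos) (auto intro: add_pos_pos less_le_trans)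
  also have "\<dots> \<le> entry_pairing U R (Y ** Y) * (1 / (m * (m + x))) / (\<alpha> + x)"
    unfolding sum_divide_distrib[symmetric] using bound assms by (intro divide_right_mono) auto
  also have "\<dots> = entry_pairing U R (Y ** Y) / m * (1 / ((\<alpha> + x) * (m + x)))"
    by simp
  finally show ?thesis .
qed

text \<open>\<open>log_gap'_le\<close> integrated over all x > 0. The bound \<open>\<alpha>\<close>
  may be small, since \<open>ln_dd \<alpha> m\<close> grows only logarithmically as it tends to
  0.\<close>

theorem log_gap_ge:
  assumes "0 < \<alpha>" "\<And>j. \<alpha> \<le> a j" "0 < m" "\<And>k. 0 < s k \<Longrightarrow> m \<le> s k"
  shows "- (entry_pairing U R (Y ** Y) / m * ln_dd \<alpha> m) \<le> log_gap 0"
proof -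
  let ?K = "entry_pairing U R (Y ** Y) / m"
  define f where "f x = - log_gap x - ?K * ln_dd (\<alpha> + x) (m + x)" for x
  have ln_dd: "((\<lambda>x. ln_dd (\<alpha> + x) (m + x)) has_real_derivative - (1 / ((\<alpha> + x) * (m + x)))) (at x)"
    if "0 \<le> x" for x
    using assms that by (intro has_real_derivative_ln_dd) auto
  have "f 0 \<le> 0"
  proof (rule nonpos_of_deriv_nonneg_tendsto_0)
    show "(f has_real_derivative - log_gap' x - ?K * - (1 / ((\<alpha> + x) * (m + x)))) (at x)"
      if "0 < x" for x
      unfolding f_def using that
      by (intro DERIV_diff DERIV_minus DERIV_cmult log_gap_has_derivative ln_dd) auto
    show "0 \<le> - log_gap' x - ?K * - (1 / ((\<alpha> + x) * (m + x)))" if "0 < x" for x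
      using log_gap'_le[OF that assms] by simp
    show "continuous_on {0..} f"
      unfolding f_def using ln_dd
      by (intro continuous_intros continuous_on_log_gap continuous_at_imp_continuous_on)
        (auto intro: DERIV_isCont)
    have "(f \<longlongrightarrow> - 0 - ?K * 0) at_top"
      unfolding f_def by (intro tendsto_intros log_gap_tendsto_0 tendsto_ln_dd_at_top)
    then show "(f \<longlongrightarrow> 0) at_top" by simp
  qed
  then show ?thesis by (simp add: f_def)
qed

end

section \<open>States\<close>

lemma states_iff: "A \<in> states \<longleftrightarrow> A \<in> psd_mats \<and> trace A = 1"
  by (simp add: states_def state_on_def psd_mats_def trace_def)

lemma closed_psd_mats: "closed (psd_mats :: (complex^'n^'n) set)"
proof -
  have "(psd_mats :: (complex^'n^'n) set) =
    {A. \<forall>i j. cnj (A $ j $ i) = A $ i $ j} \<inter> {A. \<forall>v. 0 \<le> Re (cip v (A *v v))}"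
    by (auto simp: psd_mats_iff vec_eq_iff)
  also have "closed \<dots>"
    unfolding cip_def matrix_vector_mult_def vec_lambda_beta
    by (intro closed_Int closed_Collect_all closed_Collect_eq closed_Collect_le continuous_intros)
  finally show ?thesis .
qed

lemma convex_psd_mats: "convex (psd_mats :: (complex^'n^'n) set)"
proof (rule convexI)
  fix A B :: "complex^'n^'n" and u v :: real
  assume AB: "A \<in> psd_mats" "B \<in> psd_mats" and "0 \<le> u" "0 \<le> v"
  have "cip x ((u *\<^sub>R A + v *\<^sub>R B) *v x) = u *\<^sub>R cip x (A *v x) + v *\<^sub>R cip x (B *v x)" for x
  proof -
    have "(u *\<^sub>R A + v *\<^sub>R B) *v x = u *\<^sub>R (A *v x) + v *\<^sub>R (B *v x)"
      by (simp add: vec_eq_iff matrix_vector_mult_def algebra_simps sum.distrib scaleR_sum_right)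
    then show ?thesis
      by (simp only: cip_add_right cip_scaleR_right)
  qed
  then show "u *\<^sub>R A + v *\<^sub>R B \<in> psd_mats"
    using AB \<open>0 \<le> u\<close> \<open>0 \<le> v\<close> by (auto simp: psd_mats_iff adj_add adj_scaleR)
qed

lemma closed_states: "closed (states :: (complex^'n^'n) set)"
proof -
  have "states = (psd_mats :: (complex^'n^'n) set) \<inter> {A. trace A = 1}"
    by (auto simp: states_iff)
  also have "closed \<dots>"
    unfolding trace_def by (intro closed_Int closed_psd_mats closed_Collect_eq continuous_intros)
  finally show ?thesis .
qed

lemma convex_states: "convex (states :: (complex^'n^'n) set)"
proof (rule convexI)
  fix A B :: "complex^'n^'n" and u v :: real
  assume *: "A \<in> states" "B \<in> states" "0 \<le> u" "0 \<le> v" "u + v = 1"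
  then have "trace (u *\<^sub>R A + v *\<^sub>R B) = 1"
    by (simp add: states_iff trace_add trace_scaleR flip: scaleR_left_distrib)
  with * show "u *\<^sub>R A + v *\<^sub>R B \<in> states"
    using convexD[OF convex_psd_mats] by (auto simp: states_iff)
qed

section \<open>PPT states\<close>

lemma partial_transpose_nth:
  "partial_transpose e K A $ i $ j = A $ mix_index e K i j $ mix_index e K j i"
  by (simp add: partial_transpose_def)

lemma closed_ppt_states: "closed (ppt_states e)"
proof -
  have "ppt_states e = states \<inter> (\<Inter>K. partial_transpose e K -` psd_mats)"
    by (auto simp: ppt_states_def)
  also have "closed \<dots>"
  proof (intro closed_Int closed_states closed_INT ballI closed_vimage closed_psd_mats)
    show "continuous_on UNIV (partial_transpose e K)" for K
      unfolding partial_transpose_def by (intro continuous_intros)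
  qed
  finally show ?thesis .
qed

lemma convex_ppt_states: "convex (ppt_states e)"
proof (rule convexI)
  fix A B and u v :: real
  assume *: "A \<in> ppt_states e" "B \<in> ppt_states e" "0 \<le> u" "0 \<le> v" "u + v = 1"
  have "partial_transpose e K (u *\<^sub>R A + v *\<^sub>R B) =
      u *\<^sub>R partial_transpose e K A + v *\<^sub>R partial_transpose e K B" for K
    by (simp add: vec_eq_iff partial_transpose_nth)
  with * show "u *\<^sub>R A + v *\<^sub>R B \<in> ppt_states e"
    by (auto simp: ppt_states_def intro!: convexD[OF convex_psd_mats] convexD[OF convex_states])
qed

lemma diag_mat_const_mul: "diag_mat (\<lambda>k. c) *v x = c *\<^sub>R (x :: complex^'n)"
  by (simp add: vec_eq_iff matrix_vector_mult_def diag_mat_def if_distrib[of "\<lambda>z. z * _"]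
      cong: if_cong) (simp add: scaleR_conv_of_real)

lemma psd_mats_diag_const: "0 \<le> c \<Longrightarrow> diag_mat (\<lambda>k. c) \<in> psd_mats"
  by (simp add: psd_mats_iff diag_mat_const_mul cip_scaleR_right cip_self)

lemma tensor_index_less:
  assumes "tensor_index d e"
  shows "e i k < d k"
proof -
  have "e i \<in> {m. \<forall>k. m k < d k}"
    using assms bij_betwE unfolding tensor_index_def by blast
  then show ?thesis by blast
qed

text \<open>In each component the two mixed indices carry the components of \<open>i\<close> and
  \<open>j\<close> in opposite order, so they agree only if \<open>i = j\<close>. Hence partial
  transposition fixes scalar matrices.\<close>

lemma mix_index_swap_eq_iff:
  assumes "tensor_index d e"
  shows "mix_index e K i j = mix_index e K j i \<longleftrightarrow> i = j"
proof
  have bij: "bij_betw e UNIV {m. \<forall>k. m k < d k}"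
    using assms by (simp add: tensor_index_def)
  have mix: "e (mix_index e K i j) = (\<lambda>k. if k \<in> K then e j k else e i k)" for i j
    unfolding mix_index_def
  proof (rule f_inv_into_f)
    show "(\<lambda>k. if k \<in> K then e j k else e i k) \<in> range e"
      using bij tensor_index_less[OF assms] by (simp add: bij_betw_def)
  qed
  assume "mix_index e K i j = mix_index e K j i"
  then have "(\<lambda>k. if k \<in> K then e j k else e i k) = (\<lambda>k. if k \<in> K then e i k else e j k)"
    using mix by metis
  then have "e i = e j"
    by (metis ext)
  then show "i = j"
    using bij by (auto simp: bij_betw_def dest: injD)
qed simp

text \<open>The maximally mixed state serves as a positive definite element of
  \<open>D\<close>.\<close>

lemma scalar_in_ppt_states:
  fixes e :: "'n::finite \<Rightarrow> 's::finite \<Rightarrow> nat"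
  assumes "tensor_index d e"
  shows "diag_mat (\<lambda>k. 1 / real CARD('n)) \<in> ppt_states e"
proof -
  have "partial_transpose e K (diag_mat (\<lambda>k. c)) = diag_mat (\<lambda>k. c)" for K c
    by (simp add: vec_eq_iff partial_transpose_nth)
      (simp add: diag_mat_def mix_index_swap_eq_iff[OF assms])
  moreover have "diag_mat (\<lambda>k. 1 / real CARD('n)) \<in> (states :: (complex^'n^'n) set)"
    by (simp add: states_iff psd_mats_diag_const) (simp add: trace_def diag_mat_def)
  ultimately show ?thesis
    by (auto simp: ppt_states_def psd_mats_diag_const)
qed

section \<open>Separable states\<close>

text \<open>Schur product theorem. By the spectral decomposition of \<open>B\<close>, the form of
  the product at \<open>v\<close> is a sum, weighted by the eigenvalues \<open>s l\<close>, of forms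
  of \<open>A\<close> at the vectors \<open>w l\<close>.\<close>

lemma psd_mats_hadamard:
  fixes A B :: "complex^'n^'n"
  assumes "A \<in> psd_mats" "B \<in> psd_mats"
  shows "(\<chi> i j. A $ i $ j * B $ i $ j) \<in> psd_mats"
proof -
  have "adj B = B" using assms by (simp add: psd_mats_iff)
  then obtain U s where U: "eigenbasis B U s"
    using hermitian_eigenbasis_exists by blast
  have s: "0 \<le> s l" for l
    by (rule psd_mats_eigenbasis_nonneg[OF assms(2) U])
  have B: "B $ i $ j = (\<Sum>l\<in>UNIV. U $ i $ l * of_real (s l) * cnj (U $ j $ l))" for i j
  proof -
    have "B $ i $ j = ((U ** diag_mat s) ** adj U) $ i $ j"
      using eigenbasisD(3)[OF U] by simp
    also have "\<dots> = (\<Sum>l\<in>UNIV. (U ** diag_mat s) $ i $ l * adj U $ l $ j)"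
      by (subst matrix_matrix_mult_def) simp
    finally show ?thesis by simp
  qed
  let ?H = "\<chi> i j. A $ i $ j * B $ i $ j"
  have "0 \<le> Re (cip v (?H *v v))" for v
  proof -
    define w where "w l = (\<chi> i. cnj (U $ i $ l) * v $ i)" for l
    have "cip v (?H *v v) = (\<Sum>i\<in>UNIV. \<Sum>j\<in>UNIV. \<Sum>l\<in>UNIV.
        of_real (s l) * (cnj (w l $ i) * (A $ i $ j * w l $ j)))"
      by (simp add: cip_def matrix_vector_mult_def B w_def sum_distrib_left sum_distrib_right mult_ac)
    also have "\<dots> = (\<Sum>i\<in>UNIV. \<Sum>l\<in>UNIV. \<Sum>j\<in>UNIV.
        of_real (s l) * (cnj (w l $ i) * (A $ i $ j * w l $ j)))"
      by (intro sum.cong refl sum.swap)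
    also have "\<dots> = (\<Sum>l\<in>UNIV. \<Sum>i\<in>UNIV. \<Sum>j\<in>UNIV.
        of_real (s l) * (cnj (w l $ i) * (A $ i $ j * w l $ j)))"
      by (rule sum.swap)
    also have "\<dots> = (\<Sum>l\<in>UNIV. of_real (s l) * cip (w l) (A *v w l))"
      by (simp only: cip_def matrix_vector_mult_def vec_lambda_beta sum_distrib_left)
    finally have "Re (cip v (?H *v v)) = (\<Sum>l\<in>UNIV. s l * Re (cip (w l) (A *v w l)))"
      by simp
    also have "\<dots> \<ge> 0"
      using s assms(1) by (intro sum_nonneg mult_nonneg_nonneg) (auto simp: psd_mats_iff)
    finally show ?thesis .
  qed
  moreover have "adj ?H = ?H"
    using assms by (simp add: psd_mats_iff vec_eq_iff)
  ultimately show ?thesis by (simp add: psd_mats_iff)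
qed

lemma psd_mats_all_ones: "(\<chi> i j. 1) \<in> (psd_mats :: (complex^'n^'n) set)"
proof -
  have "cip v ((\<chi> i j. 1) *v v) = of_real ((cmod (\<Sum>i\<in>UNIV. v $ i))\<^sup>2)" for v :: "complex^'n"
    unfolding complex_norm_square
    by (simp add: cip_def matrix_vector_mult_def mult.commute flip: sum_distrib_right)
  then show ?thesis
    by (simp add: psd_mats_iff vec_eq_iff)
qed

lemma psd_mats_prod:
  assumes "finite K" and "\<And>k. k \<in> K \<Longrightarrow> (\<chi> i j. M k i j) \<in> (psd_mats :: (complex^'n^'n) set)"
  shows "(\<chi> i j. \<Prod>k\<in>K. M k i j) \<in> (psd_mats :: (complex^'n^'n) set)"
  using assms
proof (induction K rule: finite_induct)
  case (insert k K)
  then show ?case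
    using psd_mats_hadamard[of "\<chi> i j. M k i j" "\<chi> i j. \<Prod>k\<in>K. M k i j"] by simp
qed (simp add: psd_mats_all_ones)

text \<open>With \<open>f\<close> a component of the multi-index, this writes a tensor product as an
  entrywise product of positive semidefinite matrices. Such an \<open>f\<close> is usually not
  injective; the form at \<open>v\<close> is the form of \<open>A\<close> at the sums
  \<open>x a\<close> of \<open>v\<close> over the fibres of \<open>f\<close>.\<close>

lemma psd_mats_reindex:
  fixes f :: "'n::finite \<Rightarrow> 'a"
  assumes "psd_on I A" "finite I" "\<And>i. f i \<in> I"
  shows "(\<chi> i j. A (f i) (f j)) \<in> psd_mats"
proof -
  have "0 \<le> Re (cip v ((\<chi> i j. A (f i) (f j)) *v v))" for v
  proof -
    define x where "x a = (\<Sum>i | i \<in> UNIV \<and> f i = a. v $ i)" for a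
    have "cip v ((\<chi> i j. A (f i) (f j)) *v v) =
       (\<Sum>i\<in>UNIV. cnj (v $ i) * (\<Sum>j\<in>UNIV. A (f i) (f j) * v $ j))"
      by (simp add: cip_def matrix_vector_mult_def)
    also have "\<dots> = (\<Sum>i\<in>UNIV. cnj (v $ i) * (\<Sum>b\<in>I. A (f i) b * x b))"
    proof (intro sum.cong arg_cong2[where f = "(*)"] refl)
      fix i
      have "(\<Sum>j\<in>UNIV. A (f i) (f j) * v $ j) =
         (\<Sum>b\<in>I. \<Sum>j | j \<in> UNIV \<and> f j = b. A (f i) (f j) * v $ j)"
        using assms by (intro sum.group[symmetric]) auto
      also have "\<dots> = (\<Sum>b\<in>I. A (f i) b * x b)"
        by (simp add: x_def sum_distrib_left)
      finally show "(\<Sum>j\<in>UNIV. A (f i) (f j) * v $ j) = (\<Sum>b\<in>I. A (f i) b * x b)" .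
    qed
    also have "\<dots> = (\<Sum>a\<in>I. \<Sum>i | i \<in> UNIV \<and> f i = a. cnj (v $ i) * (\<Sum>b\<in>I. A (f i) b * x b))"
      using assms by (intro sum.group[symmetric]) auto
    also have "\<dots> = (\<Sum>a\<in>I. \<Sum>b\<in>I. cnj (x a) * A a b * x b)"
    proof (intro sum.cong refl)
      fix a
      have "(\<Sum>i | i \<in> UNIV \<and> f i = a. cnj (v $ i) * (\<Sum>b\<in>I. A (f i) b * x b)) =
          cnj (x a) * (\<Sum>b\<in>I. A a b * x b)"
        unfolding x_def[of a] cnj_sum sum_distrib_right by (intro sum.cong) auto
      then show "(\<Sum>i | i \<in> UNIV \<and> f i = a. cnj (v $ i) * (\<Sum>b\<in>I. A (f i) b * x b)) =
          (\<Sum>b\<in>I. cnj (x a) * A a b * x b)"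
        by (simp add: sum_distrib_left mult.assoc)
    qed
    finally show ?thesis
      using assms(1) by (simp only: psd_on_def)
  qed
  moreover have "adj (\<chi> i j. A (f i) (f j)) = (\<chi> i j. A (f i) (f j))"
  proof -
    have "cnj (A (f j) (f i)) = A (f i) (f j)" for i j
      using assms(1,3) unfolding psd_on_def hermitian_on_def by metis
    then show ?thesis
      by (simp add: vec_eq_iff)
  qed
  ultimately show ?thesis
    by (simp add: psd_mats_iff)
qed

lemma trace_tensor_mat:
  assumes "tensor_index d e"
  shows "trace (tensor_mat e R) = (\<Prod>k\<in>UNIV. \<Sum>a<d k. R k a a)"
proof -
  have "trace (tensor_mat e R) = (\<Sum>i\<in>UNIV. \<Prod>k\<in>UNIV. R k (e i k) (e i k))"
    by (simp add: trace_def tensor_mat_def)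
  also have "\<dots> = (\<Sum>m | \<forall>k. m k < d k. \<Prod>k\<in>UNIV. R k (m k) (m k))"
    using assms by (intro sum.reindex_bij_betw[where g = "\<lambda>m. \<Prod>k\<in>UNIV. R k (m k) (m k)"])
      (simp add: tensor_index_def)
  also have "{m. \<forall>k. m k < d k} = PiE UNIV (\<lambda>k. {..<d k})"
    by (auto simp: PiE_def Pi_def)
  finally show ?thesis
    by (simp add: prod_sum_PiE)
qed

lemma product_states_subset_states:
  assumes "tensor_index d e"
  shows "product_states d e \<subseteq> states"
proof
  fix A assume "A \<in> product_states d e"
  then obtain R where A: "A = tensor_mat e R" and R: "\<And>k. state_on {..<d k} (R k)"
    by (auto simp: product_states_def)
  have "(\<chi> i j. R k (e i k) (e j k)) \<in> psd_mats" for k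
    using R tensor_index_less[OF assms]
    by (intro psd_mats_reindex[where I = "{..<d k}"]) (auto simp: state_on_def)
  then have "A \<in> psd_mats"
    unfolding A tensor_mat_def by (intro psd_mats_prod finite)
  moreover have "trace A = 1"
    using R by (simp add: A trace_tensor_mat[OF assms] state_on_def)
  ultimately show "A \<in> states"
    by (simp add: states_iff)
qed

lemma separable_states_subset_states:
  "tensor_index d e \<Longrightarrow> separable_states d e \<subseteq> states"
  unfolding separable_states_def
  by (intro hull_minimal product_states_subset_states convex_states)

text \<open>The tensor product of the maximally mixed states of the factors is a scalar
  matrix.\<close>

lemma scalar_in_separable_states:
  fixes e :: "'n::finite \<Rightarrow> 's::finite \<Rightarrow> nat"
  assumes "tensor_index d e"
  shows "\<exists>c>0. diag_mat (\<lambda>k. c) \<in> separable_states d e"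
proof -
  have d: "0 < d k" for k
    using assms by (simp add: tensor_index_def Suc_le_eq)
  define R where "R k a b = (if a = b then of_real (1 / real (d k)) else 0 :: complex)" for k and a b :: nat
  have "state_on {..<d k} (R k)" for k
  proof -
    have quad: "(\<Sum>i<d k. \<Sum>j<d k. cnj (v i) * R k i j * v j) = (\<Sum>i<d k. of_real ((cmod (v i))\<^sup>2 / real (d k)))" for v
    proof (intro sum.cong refl)
      fix i assume "i \<in> {..<d k}"
      then have "(\<Sum>j<d k. cnj (v i) * R k i j * v j) = (\<Sum>j<d k. if j = i then cnj (v i) * R k i i * v i else 0)"
        by (intro sum.cong) (auto simp: R_def)
      also have "\<dots> = cnj (v i) * R k i i * v i"
        using \<open>i \<in> _\<close> by simp
      also have "\<dots> = of_real ((cmod (v i))\<^sup>2 / real (d k))"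
        by (simp add: R_def complex_norm_square del: of_real_power)
      finally show "(\<Sum>j<d k. cnj (v i) * R k i j * v j) = of_real ((cmod (v i))\<^sup>2 / real (d k))" .
    qed
    have "(\<Sum>i<d k. R k i i) = 1"
      using d[of k] by (simp add: R_def)
    moreover have "R k j i = cnj (R k i j)" for i j
      by (simp add: R_def)
    moreover have "0 \<le> Re (\<Sum>i<d k. \<Sum>j<d k. cnj (v i) * R k i j * v j)" for v
      unfolding quad Re_sum Re_complex_of_real by (intro sum_nonneg) auto
    ultimately show ?thesis
      unfolding state_on_def psd_on_def hermitian_on_def by blast
  qed
  then have "tensor_mat e R \<in> separable_states d e"
    unfolding separable_states_def by (intro hull_inc) (auto simp: product_states_def)
  moreover have "tensor_mat e R = diag_mat (\<lambda>k. \<Prod>k\<in>UNIV. 1 / real (d k))"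
  proof -
    have "(\<Prod>k\<in>UNIV. R k (e i k) (e j k)) = (if i = j then \<Prod>k\<in>UNIV. 1 / of_nat (d k) else 0)" for i j
    proof (cases "i = j")
      case False
      then have "e i \<noteq> e j"
        using assms by (auto simp: tensor_index_def bij_betw_def dest: injD)
      then obtain k where "e i k \<noteq> e j k" by blast
      then show ?thesis
        using False by (auto intro!: prod_zero simp: R_def)
    qed (simp add: R_def)
    then show ?thesis
      by (simp add: vec_eq_iff tensor_mat_def diag_mat_def)
  qed
  moreover have "(\<Prod>k\<in>UNIV. 1 / real (d k)) > 0"
    using d by (intro prod_pos) auto
  ultimately show ?thesis by metis
qed

text \<open>Supplies the boundedness behind the compactness of the product states. Testing
  positivity on vectors supported on \<open>a\<close> and \<open>b\<close> bounds twice the modulus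
  of \<open>A a b\<close> by the sum of two diagonal entries, each at most the trace.\<close>

lemma state_on_norm_le_1:
  assumes "state_on I A" "finite I" "a \<in> I" "b \<in> I"
  shows "cmod (A a b) \<le> 1"
proof -
  have herm: "A j i = cnj (A i j)" if "i \<in> I" "j \<in> I" for i j
    using assms(1) that unfolding state_on_def psd_on_def hermitian_on_def by blast
  have pos: "0 \<le> Re (\<Sum>i\<in>I. \<Sum>j\<in>I. cnj (v i) * A i j * v j)" for v
    using assms(1) by (simp only: state_on_def psd_on_def)
  have restrict: "(\<Sum>i\<in>I. \<Sum>j\<in>I. cnj (v i) * A i j * v j) = (\<Sum>i\<in>J. \<Sum>j\<in>J. cnj (v i) * A i j * v j)"
    if "J \<subseteq> I" "\<And>i. i \<notin> J \<Longrightarrow> v i = 0" for v J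
  proof -
    have "(\<Sum>i\<in>I. \<Sum>j\<in>I. cnj (v i) * A i j * v j) = (\<Sum>i\<in>I. \<Sum>j\<in>J. cnj (v i) * A i j * v j)"
      using that assms(2) by (intro sum.cong sum.mono_neutral_right refl) auto
    also have "\<dots> = (\<Sum>i\<in>J. \<Sum>j\<in>J. cnj (v i) * A i j * v j)"
      using that assms(2) by (intro sum.mono_neutral_right) auto
    finally show ?thesis .
  qed
  have Im: "Im (A i i) = 0" if "i \<in> I" for i
    using herm[OF that that] by (metis complex_cnj_cancel_iff Reals_cnj_iff complex_is_Real_iff)
  have diag_nonneg: "0 \<le> Re (A i i)" if "i \<in> I" for i
  proof -
    have "(\<Sum>k\<in>I. \<Sum>l\<in>I. cnj (if k = i then 1 else 0) * A k l * (if l = i then 1 else 0)) = A i i"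
      using that by (subst restrict[of "{i}"]) auto
    then show ?thesis
      using pos[of "\<lambda>k. if k = i then 1 else 0"] by metis
  qed
  have "(\<Sum>i\<in>I. Re (A i i)) = 1"
    using assms(1) by (simp add: state_on_def flip: Re_sum)
  then have diag_le: "Re (A i i) \<le> 1" if "i \<in> I" for i
    using member_le_sum[of i I "\<lambda>i. Re (A i i)"] diag_nonneg that assms(2) by auto
  show ?thesis
  proof (cases "a = b \<or> A a b = 0")
    case True
    then show ?thesis
      using Im[OF assms(3)] diag_nonneg[OF assms(3)] diag_le[OF assms(3)]
      by (auto simp: cmod_eq_Re)
  next
    case False
    \<comment> \<open>The phase for which both cross terms of the form at \<open>v\<close> equal
      minus the modulus of \<open>A a b\<close>.\<close>
    define z where "z = - sgn (cnj (A a b))"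
    define v where "v k = (if k = a then 1 else if k = b then z else 0)" for k
    have ba: "A b a = cnj (A a b)"
      using herm assms by blast
    have zz: "cnj z * z = 1"
      using False by (metis (no_types, lifting) complex_cnj_zero_iff complex_norm_square mult.commute norm_minus_cancel norm_sgn of_real_1 one_power2 z_def)
    have zA: "z * A a b = - of_real (cmod (A a b))"
    proof -
      have "z * A a b = - (A a b * cnj (A a b) / of_real (cmod (A a b)))"
        by (simp add: z_def sgn_eq)
      also have "\<dots> = - of_real (cmod (A a b))"
        using False unfolding complex_norm_square[symmetric] by (simp add: power2_eq_square)
      finally show ?thesis .
    qed
    have "(\<Sum>i\<in>I. \<Sum>j\<in>I. cnj (v i) * A i j * v j) =
      A a a + z * A a b + cnj (z * A a b) + cnj z * z * A b b"
      using False assms by (subst restrict[of "{a, b}"]) (auto simp: v_def ba algebra_simps)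
    then have "0 \<le> Re (A a a) - 2 * cmod (A a b) + Re (A b b)"
      using pos[of v] unfolding zz zA by simp
    then show ?thesis
      using diag_le[OF assms(3)] diag_le[OF assms(4)] by simp
  qed
qed

lemma compact_PiE_UNIV:
  fixes S :: "'a \<Rightarrow> 'b::topological_space set"
  assumes "\<And>i. compact (S i)"
  shows "compact (PiE UNIV S)"
  using compactin_PiE[of "\<lambda>i. euclidean" UNIV S] assms
  by (simp add: euclidean_product_topology)

text \<open>The continuous image of a compact set of parameters \<open>R\<close>. Since
  \<open>state_on {..<d k}\<close> leaves entries outside the block free, the parameters are
  confined to \<open>Box\<close>, a product of unit discs that is compact by Tychonoff.\<close>

lemma compact_product_states:
  fixes e :: "'n::finite \<Rightarrow> 's::finite \<Rightarrow> nat"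
  assumes "tensor_index d e"
  shows "compact (product_states d e)"
proof -
  define Box :: "('s \<Rightarrow> nat \<Rightarrow> nat \<Rightarrow> complex) set"
    where "Box = PiE UNIV (\<lambda>k. PiE UNIV (\<lambda>a. PiE UNIV (\<lambda>b. cball 0 1)))"
  define C where "C = {R :: 's \<Rightarrow> nat \<Rightarrow> nat \<Rightarrow> complex. \<forall>k. state_on {..<d k} (R k)}"
  have coord: "continuous_on UNIV (\<lambda>R :: 's \<Rightarrow> nat \<Rightarrow> nat \<Rightarrow> complex. R k a b)" for k a b
    using continuous_on_product_then_coordinatewise[OF continuous_on_product_then_coordinatewise[OF
        continuous_on_product_coordinates]] .
  have "closed C"
  proof -
    have "C = {R. \<forall>k. (\<forall>i\<in>{..<d k}. \<forall>j\<in>{..<d k}. R k j i = cnj (R k i j)) \<and>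
      (\<forall>v. 0 \<le> Re (\<Sum>i<d k. \<Sum>j<d k. cnj (v i) * R k i j * v j)) \<and> (\<Sum>i<d k. R k i i) = 1}"
      by (simp only: C_def state_on_def psd_on_def hermitian_on_def conj_assoc)
    also have "closed \<dots>"
      unfolding Ball_def
      by (intro closed_Collect_all closed_Collect_conj closed_Collect_imp closed_Collect_eq
          closed_Collect_le continuous_intros coord open_Collect_const)
    finally show ?thesis .
  qed
  moreover have "compact Box"
    unfolding Box_def by (intro compact_PiE_UNIV compact_cball)
  ultimately have "compact (Box \<inter> C)"
    by (rule compact_Int_closed[rotated])
  moreover have "continuous_on (Box \<inter> C) (tensor_mat e)"
    unfolding tensor_mat_def
    by (intro continuous_intros continuous_on_subset[OF coord]) auto
  ultimately have "compact (tensor_mat e ` (Box \<inter> C))"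
    by (rule compact_continuous_image[rotated])
  also have "tensor_mat e ` (Box \<inter> C) = product_states d e"
  proof
    show "tensor_mat e ` (Box \<inter> C) \<subseteq> product_states d e"
      by (auto simp: product_states_def C_def)
    show "product_states d e \<subseteq> tensor_mat e ` (Box \<inter> C)"
    proof
      fix A assume "A \<in> product_states d e"
      then obtain R where A: "A = tensor_mat e R" and R: "\<And>k. state_on {..<d k} (R k)"
        by (auto simp: product_states_def)
      \<comment> \<open>Clearing the entries outside the blocks moves the family into
        \<open>Box\<close> without changing its tensor product.\<close>
      define R' where "R' k a b = (if a < d k \<and> b < d k then R k a b else 0)" for k a b
      have "state_on {..<d k} (R' k) = state_on {..<d k} (R k)" for k
        by (simp add: state_on_def psd_on_def hermitian_on_def R'_def)
      then have "R' \<in> C" using R by (simp add: C_def)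
      moreover have "R' \<in> Box"
        using state_on_norm_le_1[OF R] by (auto simp: Box_def R'_def)
      moreover have "A = tensor_mat e R'"
        using tensor_index_less[OF assms] by (simp add: A tensor_mat_def R'_def vec_eq_iff)
      ultimately show "A \<in> tensor_mat e ` (Box \<inter> C)" by blast
    qed
  qed
  finally show ?thesis .
qed

lemma closed_separable_states: "tensor_index d e \<Longrightarrow> closed (separable_states d e)"
  unfolding separable_states_def
  by (intro compact_imp_closed compact_convex_hull compact_product_states)

lemma state_boundary_subset:
  assumes "closed D" "D \<subseteq> states"
  shows "state_boundary D \<subseteq> D"
  unfolding state_boundary_def
proof (rule frontier_of_subset_closedin[OF closed_subset])
  show "D \<subseteq> {A \<in> hermitian_mats. trace A = 1}"
    using assms(2) by (auto simp: states_iff psd_mats_iff hermitian_mats_iff)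
qed fact

section \<open>Spectral functions of a state\<close>

lemma trace_cong_conj:
  fixes A B U :: "complex^'n^'n"
  assumes "adj U ** U = mat 1"
  shows "trace (A ** B) = (\<Sum>k\<in>UNIV. \<Sum>l\<in>UNIV. (adj U ** A ** U) $ k $ l * (adj U ** B ** U) $ l $ k)"
proof -
  have "U ** adj U = mat 1"
    using assms by (simp add: matrix_left_right_inverse)
  then have "(adj U ** A ** U) ** (adj U ** B ** U) = adj U ** (A ** B) ** U"
    by (metis matrix_mul_assoc matrix_mul_rid)
  then have "trace (A ** B) = trace ((adj U ** A ** U) ** (adj U ** B ** U))"
    using trace_unitary_conj[OF assms, of "A ** B"] by simp
  also have "\<dots> = (\<Sum>k\<in>UNIV. \<Sum>l\<in>UNIV. (adj U ** A ** U) $ k $ l * (adj U ** B ** U) $ l $ k)"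
    by (rule trace_matrix_mul)
  finally show ?thesis .
qed

lemma unitary_conj_cancel:
  fixes U :: "complex^'n^'n"
  assumes "adj U ** U = mat 1"
  shows "adj U ** (U ** M ** adj U) ** U = M"
  using assms by (metis matrix_mul_assoc matrix_mul_lid matrix_mul_rid)

lemma unitary_conj_eqI:
  fixes A B U :: "complex^'n^'n"
  assumes "adj U ** U = mat 1" and "\<And>k l. (adj U ** A ** U) $ k $ l = (adj U ** B ** U) $ k $ l"
  shows "A = B"
proof -
  have "U ** adj U = mat 1"
    using assms by (simp add: matrix_left_right_inverse)
  moreover have "adj U ** A ** U = adj U ** B ** U"
    using assms(2) by (simp add: vec_eq_iff)
  ultimately show ?thesis
    by (metis matrix_mul_assoc matrix_mul_lid matrix_mul_rid)
qed

lemma ln_dd_pos: "0 < a \<Longrightarrow> 0 < b \<Longrightarrow> 0 < ln_dd a b"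
  by (cases a b rule: linorder_cases) (auto simp: ln_dd_def divide_simps)

lemma ln_dd_commute: "ln_dd a b = ln_dd b a"
  by (simp add: ln_dd_def) (metis minus_diff_eq minus_divide_divide)

text \<open>The eigenbasis is the one picked by \<open>some_eigenbasis\<close>, so that
  \<open>mat_log \<sigma>\<close> and \<open>L_ddag \<sigma>\<close> are literally formulas in
  \<open>U\<close> and \<open>s\<close>.\<close>

locale spectral_data =
  fixes \<sigma> U :: "complex^'n^'n" and s :: "'n \<Rightarrow> real"
  assumes some_eig: "some_eigenbasis \<sigma> = (U, s)" and psd: "\<sigma> \<in> psd_mats"
begin

lemma eig: "eigenbasis \<sigma> U s"
  using eigenbasis_some_eigenbasis[of \<sigma>] psd some_eig by (simp add: psd_mats_iff)

lemma unitary: "adj U ** U = mat 1" "U ** adj U = mat 1"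
  using eigenbasisD[OF eig] by auto

lemma s_nonneg: "0 \<le> s k"
  by (rule psd_mats_eigenbasis_nonneg[OF psd eig])

lemma conj_sigma_nth: "(adj U ** \<sigma> ** U) $ k $ l = (if k = l then of_real (s k) else 0)"
  using eig by (simp add: eigenbasis_def diag_mat_def)

lemma mat_log_eq: "mat_log \<sigma> = log_in_basis U s"
  by (simp add: mat_log_def log_in_basis_def some_eig)

text \<open>The multiplier of \<open>L_ddag\<close> is the reciprocal of \<open>ln_dd\<close>, so
  \<open>L_ddag \<sigma>\<close> and \<open>L_in_basis U s\<close> are inverse to each other on
  matrices living on the support of \<sigma>.\<close>

lemma conj_L_ddag_nth:
  "(adj U ** L_ddag \<sigma> \<xi> ** U) $ k $ l =
     (if 0 < s k \<and> 0 < s l then (adj U ** \<xi> ** U) $ k $ l / of_real (ln_dd (s k) (s l)) else 0)"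
proof -
  have "adj U ** L_ddag \<sigma> \<xi> ** U = (\<chi> k l. if s k > 0 \<and> s l > 0
             then (adj U ** \<xi> ** U) $ k $ l *
               of_real (if s k = s l then s k else (s k - s l) / (ln (s k) - ln (s l)))
             else 0)"
    by (simp add: L_ddag_def some_eig unitary_conj_cancel[OF unitary(1)])
  then show ?thesis
    by (simp add: ln_dd_def)
qed

lemma conj_L_in_basis_nth:
  "(adj U ** L_in_basis U s \<xi> ** U) $ k $ l =
     (if 0 < s k \<and> 0 < s l then (adj U ** \<xi> ** U) $ k $ l * of_real (ln_dd (s k) (s l)) else 0)"
  unfolding L_in_basis_def unitary_conj_cancel[OF unitary(1)] by simp

lemma kernel_iff: "\<sigma> *v x = 0 \<longleftrightarrow> (\<forall>k. 0 < s k \<longrightarrow> (adj U *v x) $ k = 0)"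
proof -
  have "\<sigma> *v x = 0 \<longleftrightarrow> adj U *v (\<sigma> *v x) = 0"
    using unitary by (metis matrix_vector_mul_assoc matrix_vector_mul_lid matrix_vector_mult_0_right)
  also have "adj U *v (\<sigma> *v x) = diag_mat s *v (adj U *v x)"
    using eigenbasisD(3)[OF eig] unitary(1)
    by (metis matrix_mul_assoc matrix_mul_lid matrix_vector_mul_assoc)
  also have "\<dots> = (\<chi> k. of_real (s k) * (adj U *v x) $ k)"
    by (simp add: vec_eq_iff diag_mat_def matrix_vector_mult_def[of "diag_mat s"] matrix_vector_mult_def[of "\<chi> k l. _ k l"]
        if_distrib[of "\<lambda>z. z * _"] cong: if_cong)
  also have "\<dots> = 0 \<longleftrightarrow> (\<forall>k. 0 < s k \<longrightarrow> (adj U *v x) $ k = 0)"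
    using s_nonneg by (auto simp: vec_eq_iff less_le)
  finally show ?thesis .
qed

lemma kernel_le_of_conj:
  assumes "\<And>k l. s l = 0 \<Longrightarrow> (adj U ** B ** U) $ k $ l = 0" and "\<sigma> *v x = 0"
  shows "B *v x = 0"
proof -
  have "adj U *v (B *v x) = (adj U ** B ** U) *v (adj U *v x)"
    using unitary by (metis matrix_mul_assoc matrix_mul_rid matrix_vector_mul_assoc)
  also have "\<dots> = 0"
  proof -
    have *: "(adj U ** B ** U) $ k $ l * (adj U *v x) $ l = 0" for k l
      using assms(1)[of l k] assms(2) s_nonneg[of l] by (cases "s l = 0") (auto simp: kernel_iff less_le)
    then show ?thesis
      unfolding matrix_vector_mult_def[of "adj U ** B ** U"] * by (simp add: vec_eq_iff)
  qed
  finally show ?thesis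
    using unitary(2) by (metis matrix_vector_mul_assoc matrix_vector_mul_lid matrix_vector_mult_0_right)
qed

lemma conj_eq_0_of_kernel:
  assumes "adj B = B" and "\<And>x. \<sigma> *v x = 0 \<Longrightarrow> B *v x = 0" and "s k = 0 \<or> s l = 0"
  shows "(adj U ** B ** U) $ k $ l = 0"
proof -
  have "adj (adj U ** B ** U) = adj U ** B ** U"
    using assms(1) by (simp add: adj_matrix_mul matrix_mul_assoc)
  then have "(adj U ** B ** U) $ k $ l = cnj ((adj U ** B ** U) $ l $ k)"
    by (metis adj_nth)
  then show ?thesis
    using assms(3) congruence_eq_0_of_kernel[OF eig assms(2)] by auto
qed

lemma support_proj_eq:
  "support_proj \<sigma> = U ** diag_mat (\<lambda>k. if 0 < s k then 1 else 0) ** adj U" (is "_ = ?P")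
  unfolding support_proj_def
proof (rule the_equality)
  let ?D = "diag_mat (\<lambda>k. if 0 < s k then 1 else 0) :: complex^'n^'n"
  \<comment> \<open>The spectrum of the pseudoinverse of \<sigma>, which exhibits \<open>?P\<close>
    as a right multiple of \<sigma>.\<close>
  let ?E = "diag_mat (\<lambda>k. if 0 < s k then 1 / s k else 0) :: complex^'n^'n"
  have UD: "(U ** M ** adj U) ** (U ** N ** adj U) = U ** (M ** N) ** adj U" for M N
    using unitary(1) by (metis matrix_mul_assoc matrix_mul_rid)
  have DD: "?D ** ?D = ?D"
    unfolding diag_mat_mul_diag_mat by (rule arg_cong[where f = diag_mat]) auto
  have "?D = diag_mat s ** ?E"
    unfolding diag_mat_mul_diag_mat by (rule arg_cong[where f = diag_mat]) auto
  then have P1: "?P = \<sigma> ** (U ** ?E ** adj U)"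
    by (subst eigenbasisD(3)[OF eig]) (simp add: UD)
  have "diag_mat s = ?D ** diag_mat s"
    unfolding diag_mat_mul_diag_mat using s_nonneg
    by (intro arg_cong[where f = diag_mat]) (auto simp: less_le)
  then have P2: "\<sigma> = ?P ** \<sigma>"
    using eigenbasisD(3)[OF eig] UD by metis
  have range: "range (\<lambda>x. ?P *v x) = range (\<lambda>x. \<sigma> *v x)"
  proof
    show "range (\<lambda>x. ?P *v x) \<subseteq> range (\<lambda>x. \<sigma> *v x)"
      unfolding P1 matrix_vector_mul_assoc[symmetric] by blast
    show "range (\<lambda>x. \<sigma> *v x) \<subseteq> range (\<lambda>x. ?P *v x)"
    proof safe
      fix x
      have "\<sigma> *v x = ?P *v (\<sigma> *v x)"
        using P2 by (metis matrix_vector_mul_assoc)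
      then show "\<sigma> *v x \<in> range (\<lambda>x. ?P *v x)" by blast
    qed
  qed
  have herm: "adj ?P = ?P"
    by (simp add: adj_matrix_mul matrix_mul_assoc)
  have idem: "?P ** ?P = ?P"
    by (simp add: UD DD)
  show "?P \<in> hermitian_mats \<and> ?P ** ?P = ?P \<and> range (\<lambda>x. ?P *v x) = range (\<lambda>x. \<sigma> *v x)"
    using herm idem range by (simp add: hermitian_mats_iff)
  \<comment> \<open>A projection fixes its range. Two Hermitian projections with equal range
    therefore absorb each other on the left, and taking adjoints gives equality.\<close>
  have absorb: "Q ** R = R" if QQ: "Q ** Q = Q" and range: "range (\<lambda>x. R *v x) \<subseteq> range (\<lambda>x. Q *v x)"
    for Q R :: "complex^'n^'n"
    unfolding matrix_eq
  proof
    fix x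
    obtain y where "R *v x = Q *v y" using range by blast
    then show "(Q ** R) *v x = R *v x"
      using QQ by (metis matrix_vector_mul_assoc)
  qed
  fix Q :: "complex^'n^'n"
  assume Q: "Q \<in> hermitian_mats \<and> Q ** Q = Q \<and> range (\<lambda>x. Q *v x) = range (\<lambda>x. \<sigma> *v x)"
  then have QQ: "Q ** Q = Q" and Q_range: "range (\<lambda>x. Q *v x) = range (\<lambda>x. \<sigma> *v x)"
    by blast+
  have "Q ** ?P = ?P"
    by (rule absorb[OF QQ]) (simp only: Q_range range order_refl)
  moreover have "?P ** Q = Q"
    by (rule absorb[OF idem]) (simp only: Q_range range order_refl)
  moreover have "adj Q = Q"
    using Q by (simp add: hermitian_mats_iff)
  ultimately show "Q = ?P"
    using herm by (metis adj_matrix_mul)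
qed

lemma conj_support_proj_nth:
  "(adj U ** support_proj \<sigma> ** U) $ k $ l = (if k = l \<and> 0 < s k then 1 else 0)"
  unfolding support_proj_eq unitary_conj_cancel[OF unitary(1)] by (simp add: diag_mat_def)

text \<open>This explains the condition \<open>\<psi> \<noteq> support_proj \<sigma>\<close>: for
  the support projection the combination in the theorem would be \<sigma> itself, for every
  \<open>x\<close>.\<close>

lemma L_ddag_support_proj: "L_ddag \<sigma> (support_proj \<sigma>) = \<sigma>"
proof (rule unitary_conj_eqI[OF unitary(1)])
  show "(adj U ** L_ddag \<sigma> (support_proj \<sigma>) ** U) $ k $ l = (adj U ** \<sigma> ** U) $ k $ l" for k l
    using s_nonneg[of k]
    by (auto simp: conj_L_ddag_nth conj_support_proj_nth conj_sigma_nth ln_dd_def)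
qed

lemma L_ddag_L_in_basis:
  assumes "adj R = R" and "\<And>x. \<sigma> *v x = 0 \<Longrightarrow> R *v x = 0"
  shows "L_ddag \<sigma> (L_in_basis U s R) = R"
proof (rule unitary_conj_eqI[OF unitary(1)])
  fix k l
  show "(adj U ** L_ddag \<sigma> (L_in_basis U s R) ** U) $ k $ l = (adj U ** R ** U) $ k $ l"
  proof (cases "0 < s k \<and> 0 < s l")
    case True
    then show ?thesis
      using ln_dd_pos[of "s k" "s l"] by (simp add: conj_L_ddag_nth conj_L_in_basis_nth)
  next
    case False
    then have "s k = 0 \<or> s l = 0"
      using s_nonneg[of k] s_nonneg[of l] by linarith
    then show ?thesis
      using False conj_eq_0_of_kernel[OF assms] by (auto simp: conj_L_ddag_nth)
  qed
qed

text \<open>\<open>L\<^sub>\<sigma>\<close> sends \<sigma> to its support projection, because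
  \<open>s k * ln_dd (s k) (s k) = 1\<close> on the support, and undoes
  \<open>L_ddag\<close>.\<close>

lemma L_in_basis_combination:
  assumes "adj \<psi> = \<psi>" and "\<And>x. \<sigma> *v x = 0 \<Longrightarrow> \<psi> *v x = 0"
  shows "L_in_basis U s ((1 - x) *\<^sub>R \<sigma> + x *\<^sub>R L_ddag \<sigma> \<psi>) = (1 - x) *\<^sub>R support_proj \<sigma> + x *\<^sub>R \<psi>"
proof (rule unitary_conj_eqI[OF unitary(1)])
  fix k l
  have lin: "(adj U ** ((1 - x) *\<^sub>R A + x *\<^sub>R B) ** U) $ k $ l =
     (1 - x) *\<^sub>R (adj U ** A ** U) $ k $ l + x *\<^sub>R (adj U ** B ** U) $ k $ l" for A B
    by (simp add: matrix_add_ldistrib matrix_add_rdistrib matrix_mul_scaleR_left matrix_mul_scaleR_right)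
  show "(adj U ** L_in_basis U s ((1 - x) *\<^sub>R \<sigma> + x *\<^sub>R L_ddag \<sigma> \<psi>) ** U) $ k $ l =
     (adj U ** ((1 - x) *\<^sub>R support_proj \<sigma> + x *\<^sub>R \<psi>) ** U) $ k $ l"
  proof (cases "0 < s k \<and> 0 < s l")
    case True
    have *: "of_real (s k) * of_real (ln_dd (s k) (s k)) = (1 :: complex)"
      using True by (simp add: ln_dd_def)
    show ?thesis
      using True ln_dd_pos[of "s k" "s l"] *
      unfolding conj_L_in_basis_nth lin conj_L_ddag_nth conj_support_proj_nth conj_sigma_nth
      by (auto simp: distrib_right)
  next
    case False
    then have "s k = 0 \<or> s l = 0"
      using s_nonneg[of k] s_nonneg[of l] by linarith
    then show ?thesis
      using False conj_eq_0_of_kernel[OF assms]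
      unfolding conj_L_in_basis_nth lin conj_support_proj_nth by auto
  qed
qed

lemma L_in_basis_hermitian:
  assumes "adj R = R"
  shows "adj (L_in_basis U s R) = L_in_basis U s R"
proof (rule unitary_conj_eqI[OF unitary(1)])
  fix k l
  have *: "adj (adj U ** B ** U) = adj U ** adj B ** U" for B
    by (simp add: adj_matrix_mul matrix_mul_assoc)
  have "(adj U ** R ** U) $ k $ l = cnj ((adj U ** R ** U) $ l $ k)"
    using *[of R] assms by (metis adj_nth)
  then show "(adj U ** adj (L_in_basis U s R) ** U) $ k $ l = (adj U ** L_in_basis U s R ** U) $ k $ l"
    unfolding *[symmetric] adj_nth conj_L_in_basis_nth by (simp add: ln_dd_commute)
qed

text \<open>Against the diagonal matrix of \<sigma> only diagonal entries count, and there the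
  factor \<open>1 / s k\<close> of \<open>L\<^sub>\<sigma>\<close> cancels. This yields the
  normalization of the witness.\<close>

lemma trace_L_in_basis_sigma:
  assumes "adj R = R" and "\<And>x. \<sigma> *v x = 0 \<Longrightarrow> R *v x = 0"
  shows "trace (L_in_basis U s R ** \<sigma>) = trace R"
proof -
  have "trace (L_in_basis U s R ** \<sigma>) = (\<Sum>k\<in>UNIV. (adj U ** L_in_basis U s R ** U) $ k $ k * of_real (s k))"
    unfolding trace_cong_conj[OF unitary(1)] conj_sigma_nth
    by (simp add: if_distrib cong: if_cong)
  also have "\<dots> = (\<Sum>k\<in>UNIV. (adj U ** R ** U) $ k $ k)"
  proof (rule sum.cong[OF refl])
    fix k
    show "(adj U ** L_in_basis U s R ** U) $ k $ k * of_real (s k) = (adj U ** R ** U) $ k $ k"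
      using conj_eq_0_of_kernel[OF assms, of k k] s_nonneg[of k]
      by (cases "s k = 0") (auto simp: conj_L_in_basis_nth ln_dd_def)
  qed
  also have "\<dots> = trace R"
    using trace_unitary_conj[OF unitary(1)] by (simp add: trace_def)
  finally show ?thesis .
qed

lemma L_in_basis_kernel:
  assumes "\<sigma> *v x = 0"
  shows "L_in_basis U s R *v x = 0"
  by (rule kernel_le_of_conj[OF _ assms]) (simp add: conj_L_in_basis_nth)

lemma trace_support_proj_le:
  assumes "A \<in> psd_mats"
  shows "Re (trace (support_proj \<sigma> ** A)) \<le> Re (trace A)"
proof -
  have "trace (support_proj \<sigma> ** A) = (\<Sum>k\<in>UNIV. if 0 < s k then (adj U ** A ** U) $ k $ k else 0)"
    unfolding trace_cong_conj[OF unitary(1)] conj_support_proj_nth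
    by (rule sum.cong[OF refl]) (simp add: if_distrib[of "\<lambda>z. z * _"] sum.delta cong: if_cong)
  then have "Re (trace (support_proj \<sigma> ** A)) = (\<Sum>k\<in>UNIV. if 0 < s k then Re ((adj U ** A ** U) $ k $ k) else 0)"
    by (simp add: if_distrib[of Re] cong: if_cong)
  also have "\<dots> \<le> (\<Sum>k\<in>UNIV. Re ((adj U ** A ** U) $ k $ k))"
    using psd_mats_congruence_diag[OF assms] by (intro sum_mono) auto
  also have "\<dots> = Re (trace A)"
    using trace_unitary_conj[OF unitary(1), of A] by (simp add: trace_def flip: Re_sum)
  finally show ?thesis .
qed

section \<open>First-order comparison of logarithms at a singular state\<close>

lemma log_perturbationI:
  assumes "some_eigenbasis A = (V, a)" "A \<in> psd_mats" "R \<in> psd_mats"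
    and "\<And>x. \<sigma> *v x = 0 \<Longrightarrow> R *v x = 0" "\<And>x. A *v x = 0 \<Longrightarrow> R *v x = 0"
  shows "log_perturbation \<sigma> A R U V s a"
proof -
  interpret A: spectral_data A V a
    by unfold_locales (use assms in auto)
  show ?thesis
    by unfold_locales (use assms eig A.eig s_nonneg A.s_nonneg psd in \<open>auto simp: psd_mats_iff\<close>)
qed

theorem trace_log_le_linearization:
  assumes "A \<in> psd_mats" "R \<in> psd_mats"
    and "\<And>x. \<sigma> *v x = 0 \<Longrightarrow> R *v x = 0" "\<And>x. A *v x = 0 \<Longrightarrow> R *v x = 0"
  shows "Re (trace (R ** mat_log A)) \<le>
    Re (trace (R ** mat_log \<sigma>)) + Re (trace (L_in_basis U s R ** (A - \<sigma>)))"
proof -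
  obtain V a where V: "some_eigenbasis A = (V, a)" by fastforce
  interpret A: spectral_data A V a
    by unfold_locales (use assms V in auto)
  interpret log_perturbation \<sigma> A R U V s a
    using V assms by (rule log_perturbationI)
  show ?thesis
    using log_gap_nonpos unfolding log_gap_0 Y_def mat_log_eq A.mat_log_eq by simp
qed

text \<open>
  For positive definite \<open>\<tau>\<close> the smallest eigenvalue of \<open>\<sigma> + t (\<tau> - \<sigma>)\<close> is at least proportional to
  \<open>t\<close>, and the second-order remainder is \<open>O(t\<^sup>2 log (1/t))\<close>.
\<close>

lemma first_order_condition_definite:
  assumes R: "R \<in> psd_mats" and ker: "\<And>x. \<sigma> *v x = 0 \<Longrightarrow> R *v x = 0"
    and c: "0 < c" "\<And>v. c * (norm v)\<^sup>2 \<le> Re (cip v (\<tau> *v v))" and herm: "adj \<tau> = \<tau>"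
    and max: "\<And>t. 0 < t \<Longrightarrow> t < 1 \<Longrightarrow> (\<And>x. ((1 - t) *\<^sub>R \<sigma> + t *\<^sub>R \<tau>) *v x = 0 \<Longrightarrow> R *v x = 0) \<Longrightarrow>
      Re (trace (R ** mat_log ((1 - t) *\<^sub>R \<sigma> + t *\<^sub>R \<tau>))) \<le> Re (trace (R ** mat_log \<sigma>))"
  shows "Re (trace (L_in_basis U s R ** (\<tau> - \<sigma>))) \<le> 0"
proof -
  \<comment> \<open>A positive lower bound for the nonzero eigenvalues; the inserted 1 keeps the set
    nonempty.\<close>
  define m where "m = Min (insert 1 {s k | k. 0 < s k})"
  have fin: "finite (insert 1 {s k | k. 0 < s k})" by simp
  have m_pos: "0 < m"
    unfolding m_def by (subst Min_gr_iff) auto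
  have m_le: "m \<le> s k" if "0 < s k" for k
    unfolding m_def using that by (intro Min_le[OF fin]) auto
  let ?X = "\<tau> - \<sigma>"
  let ?E = "entry_pairing U R (?X ** ?X)"
  have bound: "Re (trace (L_in_basis U s R ** ?X)) \<le> ?E / m * (t * ln_dd (c * t) m)"
    if t: "0 < t" "t < 1" for t
  proof -
    let ?A = "(1 - t) *\<^sub>R \<sigma> + t *\<^sub>R \<tau>"
    have A_ge: "c * t * (norm v)\<^sup>2 \<le> Re (cip v (?A *v v))" for v
    proof -
      have "?A *v v = (1 - t) *\<^sub>R (\<sigma> *v v) + t *\<^sub>R (\<tau> *v v)"
        by (simp add: vec_eq_iff matrix_vector_mult_def algebra_simps sum.distrib sum_subtractf scaleR_sum_right)
      then have "Re (cip v (?A *v v)) = (1 - t) * Re (cip v (\<sigma> *v v)) + t * Re (cip v (\<tau> *v v))"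
        by (simp only: cip_add_right cip_scaleR_right plus_complex.sel scaleR_complex.sel)
      moreover have "0 \<le> (1 - t) * Re (cip v (\<sigma> *v v))"
        using psd t by (intro mult_nonneg_nonneg) (auto simp: psd_mats_iff)
      moreover have "t * (c * (norm v)\<^sup>2) \<le> t * Re (cip v (\<tau> *v v))"
        using c t by (intro mult_left_mono) auto
      ultimately show ?thesis by (simp add: mult_ac)
    qed
    have ct: "0 < c * t" using c t by simp
    have A_psd: "?A \<in> psd_mats"
      unfolding psd_mats_iff
    proof (intro conjI allI)
      show "adj ?A = ?A"
        using herm psd by (simp add: adj_add adj_scaleR psd_mats_iff)
      show "0 \<le> Re (cip v (?A *v v))" for v
        using ct by (intro order_trans[OF _ A_ge]) simp
    qed
    \<comment> \<open>For \<open>t > 0\<close> the perturbed matrix is positive definite, so its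
      kernel is trivial.\<close>
    have ker_A: "R *v v = 0" if "?A *v v = 0" for v
    proof -
      have "c * t * (norm v)\<^sup>2 \<le> 0"
        using A_ge[of v] that by (simp add: cip_def)
      then have "v = 0"
        using mult_le_cancel_left_pos[OF ct, of "(norm v)\<^sup>2" 0] by simp
      then show ?thesis by simp
    qed
    obtain V a where V: "some_eigenbasis ?A = (V, a)" by fastforce
    interpret log_perturbation \<sigma> ?A R U V s a
      using V A_psd R ker ker_A by (rule log_perturbationI)
    interpret A: spectral_data ?A V a
      by unfold_locales (use A_psd V in auto)
    have Y: "Y = t *\<^sub>R ?X"
      unfolding Y_def by (simp add: algebra_simps)
    \<comment> \<open>The remainder bound is quadratic in \<open>t\<close>, while the linear term
      only has a factor \<open>t\<close>; after division, \<open>t * ln_dd (c * t) m\<close>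
      remains.\<close>
    have YY: "Y ** Y = t\<^sup>2 *\<^sub>R (?X ** ?X)"
      by (simp add: Y matrix_mul_scaleR_left matrix_mul_scaleR_right power2_eq_square)
    have "entry_pairing U R (Y ** Y) = t\<^sup>2 * ?E"
      unfolding YY entry_pairing_def sum_distrib_left
      by (simp add: matrix_mul_scaleR_left matrix_mul_scaleR_right norm_mult mult_ac)
    then have "- (t\<^sup>2 * ?E / m * ln_dd (c * t) m) \<le> log_gap 0"
      using log_gap_ge[OF ct eigenbasis_ge[OF A.eig A_ge] m_pos m_le] by simp
    also have "\<dots> \<le> - Re (trace (L_in_basis U s R ** Y))"
      using max[OF t ker_A] unfolding log_gap_0 mat_log_eq A.mat_log_eq by simp
    also have "\<dots> = - (t * Re (trace (L_in_basis U s R ** ?X)))"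
      unfolding Y matrix_mul_scaleR_right trace_scaleR by simp
    finally have "t * Re (trace (L_in_basis U s R ** ?X)) \<le> t * (?E / m * (t * ln_dd (c * t) m))"
      by (simp add: power2_eq_square mult_ac)
    then show ?thesis
      using t by (simp only: mult_le_cancel_left_pos)
  qed
  have "((\<lambda>t. ?E / m * (t * ln_dd (c * t) m)) \<longlongrightarrow> ?E / m * 0) (at_right 0)"
    by (intro tendsto_intros tendsto_mult_ln_dd_at_right_0 c m_pos)
  moreover have "\<forall>\<^sub>F t in at_right 0. Re (trace (L_in_basis U s R ** ?X)) \<le> ?E / m * (t * ln_dd (c * t) m)"
    using eventually_at_right_real[of 0 1] by (rule eventually_mono[OF _ bound]) auto
  ultimately have "Re (trace (L_in_basis U s R ** ?X)) \<le> ?E / m * 0"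
    by (rule tendsto_lowerbound) simp
  then show ?thesis by simp
qed

end

section \<open>Closest states\<close>

lemma rel_entropy_eq:
  "rel_entropy \<rho> \<sigma> = (if \<forall>x. \<sigma> *v x = 0 \<longrightarrow> \<rho> *v x = 0
     then ereal (Re (trace (\<rho> ** mat_log \<rho>)) - Re (trace (\<rho> ** mat_log \<sigma>))) else \<infinity>)"
  by (simp add: rel_entropy_def matrix_mul_diff_ldistrib trace_sub)

text \<open>Since \<sigma>' may be singular, it is first mixed with the scalar matrix in
  \<open>D\<close>, with weight \<eta>. The definite case applies to the mixture, and the linear
  inequality survives the limit \<eta> to 0.\<close>

lemma first_order_condition:
  fixes D :: "(complex^'n^'n) set"
  assumes "D \<subseteq> states" "convex D" and c: "0 < c" "diag_mat (\<lambda>k. c) \<in> D"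
    and "\<sigma> \<in> D" "\<rho> \<in> states" and some: "some_eigenbasis \<sigma> = (U, s)"
    and min: "\<And>\<sigma>'. \<sigma>' \<in> D \<Longrightarrow> rel_entropy \<rho> \<sigma> \<le> rel_entropy \<rho> \<sigma>'"
  shows "\<And>x. \<sigma> *v x = 0 \<Longrightarrow> \<rho> *v x = 0"
    and "\<And>\<sigma>'. \<sigma>' \<in> D \<Longrightarrow> Re (trace (L_in_basis U s \<rho> ** (\<sigma>' - \<sigma>))) \<le> 0"
proof -
  have D_psd: "A \<in> psd_mats" if "A \<in> D" for A
    using that assms by (auto simp: states_iff)
  interpret spectral_data \<sigma> U s
    by unfold_locales (use assms D_psd in auto)
  \<comment> \<open>The scalar matrix has trivial kernel, so its relative entropy is finite; hence
    so is the minimum, which forces the kernel inclusion.\<close>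
  have "rel_entropy \<rho> (diag_mat (\<lambda>k. c)) \<noteq> \<infinity>"
    using c by (auto simp: rel_entropy_eq diag_mat_const_mul)
  then have "rel_entropy \<rho> \<sigma> \<noteq> \<infinity>"
    using min[OF c(2)] by auto
  then show ker: "\<rho> *v x = 0" if "\<sigma> *v x = 0" for x
    using that by (auto simp: rel_entropy_eq split: if_splits)
  fix \<sigma>' assume "\<sigma>' \<in> D"
  define p where "p A = Re (trace (L_in_basis U s \<rho> ** (A - \<sigma>)))" for A
  have lin: "p ((1 - \<eta>) *\<^sub>R A + \<eta> *\<^sub>R B) = (1 - \<eta>) * p A + \<eta> * p B" for A B \<eta>
  proof -
    have "(1 - \<eta>) *\<^sub>R A + \<eta> *\<^sub>R B - \<sigma> = (1 - \<eta>) *\<^sub>R (A - \<sigma>) + \<eta> *\<^sub>R (B - \<sigma>)"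
      by (simp add: algebra_simps)
    then show ?thesis
      by (simp add: p_def matrix_add_ldistrib matrix_mul_scaleR_right trace_add trace_scaleR)
  qed
  have le: "(1 - \<eta>) * p \<sigma>' + \<eta> * p (diag_mat (\<lambda>k. c)) \<le> 0" if \<eta>: "0 < \<eta>" "\<eta> < 1" for \<eta>
  proof -
    let ?\<tau> = "(1 - \<eta>) *\<^sub>R \<sigma>' + \<eta> *\<^sub>R diag_mat (\<lambda>k. c)"
    have \<tau>: "?\<tau> \<in> D"
      using \<eta> \<open>\<sigma>' \<in> D\<close> c by (intro convexD[OF assms(2)]) auto
    have "p ?\<tau> \<le> 0"
      unfolding p_def
    proof (rule first_order_condition_definite[where c = "\<eta> * c"])
      show "\<eta> * c * (norm v)\<^sup>2 \<le> Re (cip v (?\<tau> *v v))" for v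
      proof -
        have "?\<tau> *v v = (1 - \<eta>) *\<^sub>R (\<sigma>' *v v) + (\<eta> * c) *\<^sub>R v"
          by (simp add: vec_eq_iff matrix_vector_mult_def diag_mat_def algebra_simps sum.distrib
              sum_subtractf scaleR_sum_right if_distrib[of "\<lambda>z. _ *\<^sub>R z"] cong: if_cong)
            (simp add: if_distrib[of "\<lambda>z. _ * z"] scaleR_conv_of_real cong: if_cong)
        then have "Re (cip v (?\<tau> *v v)) = (1 - \<eta>) * Re (cip v (\<sigma>' *v v)) + \<eta> * c * (norm v)\<^sup>2"
          by (simp only: cip_add_right cip_scaleR_right plus_complex.sel scaleR_complex.sel cip_self
              Re_complex_of_real)
        moreover have "0 \<le> (1 - \<eta>) * Re (cip v (\<sigma>' *v v))"
          using D_psd[OF \<open>\<sigma>' \<in> D\<close>] \<eta> by (intro mult_nonneg_nonneg) (auto simp: psd_mats_iff)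
        ultimately show ?thesis by simp
      qed
      fix t :: real assume t: "0 < t" "t < 1"
      let ?A = "(1 - t) *\<^sub>R \<sigma> + t *\<^sub>R ?\<tau>"
      have "?A \<in> D"
        using t by (intro convexD[OF assms(2) \<open>\<sigma> \<in> D\<close> \<tau>]) auto
      then have "rel_entropy \<rho> \<sigma> \<le> rel_entropy \<rho> ?A"
        by (rule min)
      moreover assume "\<And>x. ?A *v x = 0 \<Longrightarrow> \<rho> *v x = 0"
      ultimately show "Re (trace (\<rho> ** mat_log ?A)) \<le> Re (trace (\<rho> ** mat_log \<sigma>))"
        using ker by (simp add: rel_entropy_eq)
    qed (use \<eta> c \<tau> D_psd ker \<open>\<rho> \<in> states\<close> in \<open>auto simp: states_iff psd_mats_iff\<close>)
    then show ?thesis by (simp only: lin)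
  qed
  have "((\<lambda>\<eta>. (1 - \<eta>) * p \<sigma>' + \<eta> * p (diag_mat (\<lambda>k. c))) \<longlongrightarrow>
     (1 - 0) * p \<sigma>' + 0 * p (diag_mat (\<lambda>k. c))) (at_right 0)"
    by (intro tendsto_intros tendsto_ident_at)
  moreover have "\<forall>\<^sub>F \<eta> in at_right 0. (1 - \<eta>) * p \<sigma>' + \<eta> * p (diag_mat (\<lambda>k. c)) \<le> 0"
    using eventually_at_right_real[of 0 1] by (rule eventually_mono[OF _ le]) auto
  ultimately have "(1 - 0) * p \<sigma>' + 0 * p (diag_mat (\<lambda>k. c)) \<le> 0"
    by (rule tendsto_upperbound) simp
  then show "Re (trace (L_in_basis U s \<rho> ** (\<sigma>' - \<sigma>))) \<le> 0"
    by (simp add: p_def)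
qed

lemma closest_state_imp_witness:
  fixes D :: "(complex^'n^'n) set"
  assumes "D \<subseteq> states" "convex D" "0 < c" "diag_mat (\<lambda>k. c) \<in> D"
    and "\<sigma> \<in> D" "\<rho> \<in> states" "\<rho> \<notin> D"
    and min: "\<And>\<sigma>'. \<sigma>' \<in> D \<Longrightarrow> rel_entropy \<rho> \<sigma> \<le> rel_entropy \<rho> \<sigma>'"
  shows "\<exists>\<psi> \<in> hermitian_mats. \<psi> \<noteq> support_proj \<sigma> \<and> trace (\<psi> ** \<sigma>) = 1 \<and>
       (\<forall>\<sigma>'\<in>D. Re (trace (\<psi> ** \<sigma>')) \<le> Re (trace (\<psi> ** \<sigma>))) \<and>
       (\<forall>v. \<sigma> *v v = 0 \<longrightarrow> \<psi> *v v = 0) \<and> \<rho> = L_ddag \<sigma> \<psi>"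
proof -
  obtain U s where some: "some_eigenbasis \<sigma> = (U, s)" by fastforce
  interpret spectral_data \<sigma> U s
    by unfold_locales (use assms some in \<open>auto simp: states_iff\<close>)
  have ker: "\<rho> *v v = 0" if "\<sigma> *v v = 0" for v
    using first_order_condition(1)[OF assms(1-6) some _ that] min by blast
  have first_order: "Re (trace (L_in_basis U s \<rho> ** (\<sigma>' - \<sigma>))) \<le> 0" if "\<sigma>' \<in> D" for \<sigma>'
    using first_order_condition(2)[OF assms(1-6) some _ that] min by blast
  have herm: "adj \<rho> = \<rho>" and tr: "trace \<rho> = 1"
    using \<open>\<rho> \<in> states\<close> by (auto simp: states_iff psd_mats_iff)
  let ?\<psi> = "L_in_basis U s \<rho>"
  have \<rho>: "\<rho> = L_ddag \<sigma> ?\<psi>"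
    using L_ddag_L_in_basis[OF herm ker] by simp
  \<comment> \<open>Otherwise \<rho> would equal \<sigma>, which belongs to
    \<open>D\<close>.\<close>
  then have "?\<psi> \<noteq> support_proj \<sigma>"
    using L_ddag_support_proj assms by metis
  moreover have "?\<psi> \<in> hermitian_mats"
    using L_in_basis_hermitian[OF herm] by (simp add: hermitian_mats_iff)
  moreover have "trace (?\<psi> ** \<sigma>) = 1"
    using trace_L_in_basis_sigma[OF herm ker] tr by simp
  moreover have "Re (trace (?\<psi> ** \<sigma>')) \<le> Re (trace (?\<psi> ** \<sigma>))" if "\<sigma>' \<in> D" for \<sigma>'
    using first_order[OF that] by (simp add: matrix_mul_diff_ldistrib trace_sub)
  ultimately show ?thesis
    using \<rho> L_in_basis_kernel by blast
qed

text \<open>On \<open>D\<close> the traces against \<psi> and against the support projection are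
  both at most 1, with equality at \<sigma>. So the same holds for their convex combination
  \<open>L\<^sub>\<sigma>(\<rho>)\<close>, which is the first-order condition.\<close>

lemma witness_imp_closest_state:
  fixes D :: "(complex^'n^'n) set"
  assumes "D \<subseteq> states" "\<sigma> \<in> D" "\<rho> \<in> states" "adj \<psi> = \<psi>" "trace (\<psi> ** \<sigma>) = 1"
    and max: "\<And>\<sigma>'. \<sigma>' \<in> D \<Longrightarrow> Re (trace (\<psi> ** \<sigma>')) \<le> Re (trace (\<psi> ** \<sigma>))"
    and ker: "\<And>v. \<sigma> *v v = 0 \<Longrightarrow> \<psi> *v v = 0"
    and x: "0 \<le> x" "x \<le> 1" and \<rho>: "\<rho> = (1 - x) *\<^sub>R \<sigma> + x *\<^sub>R L_ddag \<sigma> \<psi>" and "\<sigma>' \<in> D"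
  shows "rel_entropy \<rho> \<sigma> \<le> rel_entropy \<rho> \<sigma>'"
proof -
  have D: "A \<in> psd_mats" "trace A = 1" if "A \<in> D" for A
    using that assms by (auto simp: states_iff)
  obtain U s where some: "some_eigenbasis \<sigma> = (U, s)" by fastforce
  interpret spectral_data \<sigma> U s
    by unfold_locales (use D assms some in auto)
  have ker_\<rho>: "\<rho> *v v = 0" if "\<sigma> *v v = 0" for v
  proof (rule kernel_le_of_conj[OF _ that])
    show "(adj U ** \<rho> ** U) $ k $ l = 0" if "s l = 0" for k l
      using that unfolding \<rho>
      by (simp add: matrix_add_ldistrib matrix_add_rdistrib matrix_mul_scaleR_left
          matrix_mul_scaleR_right conj_sigma_nth conj_L_ddag_nth)
  qed
  have \<rho>_psd: "\<rho> \<in> psd_mats" and tr: "trace \<rho> = 1"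
    using \<open>\<rho> \<in> states\<close> by (auto simp: states_iff)
  show ?thesis
  \<comment> \<open>Where the kernel inclusion fails for \<sigma>', its relative entropy is
    infinite.\<close>
  proof (cases "\<forall>v. \<sigma>' *v v = 0 \<longrightarrow> \<rho> *v v = 0")
    case True
    let ?\<phi> = "L_in_basis U s \<rho>"
    have \<phi>: "?\<phi> = (1 - x) *\<^sub>R support_proj \<sigma> + x *\<^sub>R \<psi>"
      unfolding \<rho> by (rule L_in_basis_combination[OF assms(4) ker])
    have "Re (trace (?\<phi> ** \<sigma>')) =
        (1 - x) * Re (trace (support_proj \<sigma> ** \<sigma>')) + x * Re (trace (\<psi> ** \<sigma>'))"
      by (simp add: \<phi> matrix_add_rdistrib matrix_mul_scaleR_left trace_add trace_scaleR)
    also have "\<dots> \<le> (1 - x) * 1 + x * 1"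
      using x trace_support_proj_le[OF D(1)] D(2) max \<open>\<sigma>' \<in> D\<close> \<open>trace (\<psi> ** \<sigma>) = 1\<close>
      by (intro add_mono mult_left_mono) fastforce+
    also have "\<dots> = Re (trace (?\<phi> ** \<sigma>))"
      using trace_L_in_basis_sigma[OF _ ker_\<rho>] \<rho>_psd tr by (simp add: psd_mats_iff)
    finally have "Re (trace (?\<phi> ** (\<sigma>' - \<sigma>))) \<le> 0"
      by (simp add: matrix_mul_diff_ldistrib trace_sub)
    then have "Re (trace (\<rho> ** mat_log \<sigma>')) \<le> Re (trace (\<rho> ** mat_log \<sigma>))"
      using trace_log_le_linearization[OF D(1)[OF \<open>\<sigma>' \<in> D\<close>] \<rho>_psd ker_\<rho>] True by force
    then show ?thesis
      using True ker_\<rho> by (simp add: rel_entropy_eq)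
  next
    case False
    then show ?thesis unfolding rel_entropy_eq by auto
  qed
qed

theorem theorem7:
  fixes d :: "'s::finite \<Rightarrow> nat"
    and e :: "'n::finite \<Rightarrow> 's \<Rightarrow> nat"
    and D :: "(complex^'n^'n) set"
    and \<sigma> \<rho> :: "complex^'n^'n"
  assumes "tensor_index d e"
    and "D = separable_states d e \<or> D = ppt_states e"
    and "\<sigma> \<in> state_boundary D"
    and "\<not> invertible \<sigma>"
    and "\<rho> \<in> states"
    and "\<rho> \<notin> D"
  shows "rel_entropy_ent D \<rho> = rel_entropy \<rho> \<sigma> \<longleftrightarrow>
    (\<exists>\<psi> \<in> hermitian_mats. \<exists>x::real.
       \<psi> \<noteq> support_proj \<sigma> \<and>
       trace (\<psi> ** \<sigma>) = 1 \<and>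
       (\<forall>\<sigma>'\<in>D. Re (trace (\<psi> ** \<sigma>')) \<le> Re (trace (\<psi> ** \<sigma>))) \<and>
       (\<forall>v. \<sigma> *v v = 0 \<longrightarrow> \<psi> *v v = 0) \<and>
       0 < x \<and> x \<le> x_max \<sigma> \<psi> \<and> x_max \<sigma> \<psi> \<le> 1 \<and>
       \<rho> = (1 - x) *\<^sub>R \<sigma> + x *\<^sub>R L_ddag \<sigma> \<psi>)"
proof -
  have D_states: "D \<subseteq> states"
    using assms(2) separable_states_subset_states[OF assms(1)] by (auto simp: ppt_states_def)
  have "convex D" "closed D"
    using assms(2) closed_separable_states[OF assms(1)] convex_ppt_states closed_ppt_states
    by (auto simp: separable_states_def convex_convex_hull)
  have "\<exists>c>0. diag_mat (\<lambda>k. c) \<in> D"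
    using assms(2)
  proof
    assume "D = ppt_states e"
    then show ?thesis
      using scalar_in_ppt_states[OF assms(1)] by (intro exI[of _ "1 / real CARD('n)"]) simp
  qed (use scalar_in_separable_states[OF assms(1)] in simp)
  then obtain c where c: "0 < c" "diag_mat (\<lambda>k. c) \<in> D" by blast
  have "\<sigma> \<in> D"
    using state_boundary_subset[OF \<open>closed D\<close> D_states] assms(3) by blast
  have closest: "rel_entropy_ent D \<rho> = rel_entropy \<rho> \<sigma> \<longleftrightarrow>
      (\<forall>\<sigma>'\<in>D. rel_entropy \<rho> \<sigma> \<le> rel_entropy \<rho> \<sigma>')"
    unfolding rel_entropy_ent_def
    using \<open>\<sigma> \<in> D\<close> by (metis INF_greatest INF_lower antisym)
  show ?thesis
    unfolding closest
  proof
    assume "\<forall>\<sigma>'\<in>D. rel_entropy \<rho> \<sigma> \<le> rel_entropy \<rho> \<sigma>'"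
    then obtain \<psi> where \<psi>: "\<psi> \<in> hermitian_mats" "\<psi> \<noteq> support_proj \<sigma>" "trace (\<psi> ** \<sigma>) = 1"
      "\<forall>\<sigma>'\<in>D. Re (trace (\<psi> ** \<sigma>')) \<le> Re (trace (\<psi> ** \<sigma>))"
      "\<forall>v. \<sigma> *v v = 0 \<longrightarrow> \<psi> *v v = 0" "\<rho> = L_ddag \<sigma> \<psi>"
      using closest_state_imp_witness[OF D_states \<open>convex D\<close> c \<open>\<sigma> \<in> D\<close> assms(5,6)] by blast
    \<comment> \<open>At \<open>x = 1\<close> the combination is the state \<rho>, so the upper
      limit 1 is attained.\<close>
    have "x_max \<sigma> \<psi> = 1"
      unfolding x_max_def using \<psi>(6) assms(5) by (intro Greatest_equality) auto
    then show "\<exists>\<psi> \<in> hermitian_mats. \<exists>x::real.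
       \<psi> \<noteq> support_proj \<sigma> \<and>
       trace (\<psi> ** \<sigma>) = 1 \<and>
       (\<forall>\<sigma>'\<in>D. Re (trace (\<psi> ** \<sigma>')) \<le> Re (trace (\<psi> ** \<sigma>))) \<and>
       (\<forall>v. \<sigma> *v v = 0 \<longrightarrow> \<psi> *v v = 0) \<and>
       0 < x \<and> x \<le> x_max \<sigma> \<psi> \<and> x_max \<sigma> \<psi> \<le> 1 \<and>
       \<rho> = (1 - x) *\<^sub>R \<sigma> + x *\<^sub>R L_ddag \<sigma> \<psi>"
      using \<psi> by (intro bexI[of _ \<psi>] exI[of _ 1]) auto
  next
    assume "\<exists>\<psi> \<in> hermitian_mats. \<exists>x::real.
       \<psi> \<noteq> support_proj \<sigma> \<and>
       trace (\<psi> ** \<sigma>) = 1 \<and>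
       (\<forall>\<sigma>'\<in>D. Re (trace (\<psi> ** \<sigma>')) \<le> Re (trace (\<psi> ** \<sigma>))) \<and>
       (\<forall>v. \<sigma> *v v = 0 \<longrightarrow> \<psi> *v v = 0) \<and>
       0 < x \<and> x \<le> x_max \<sigma> \<psi> \<and> x_max \<sigma> \<psi> \<le> 1 \<and>
       \<rho> = (1 - x) *\<^sub>R \<sigma> + x *\<^sub>R L_ddag \<sigma> \<psi>"
    then obtain \<psi> x where \<psi>: "\<psi> \<in> hermitian_mats" "trace (\<psi> ** \<sigma>) = 1"
       "\<forall>\<sigma>'\<in>D. Re (trace (\<psi> ** \<sigma>')) \<le> Re (trace (\<psi> ** \<sigma>))"
       "\<forall>v. \<sigma> *v v = 0 \<longrightarrow> \<psi> *v v = 0"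
      and x: "0 < x" "x \<le> x_max \<sigma> \<psi>" "x_max \<sigma> \<psi> \<le> 1"
      and \<rho>: "\<rho> = (1 - x) *\<^sub>R \<sigma> + x *\<^sub>R L_ddag \<sigma> \<psi>"
      by blast
    have "adj \<psi> = \<psi>"
      using \<psi>(1) by (simp add: hermitian_mats_iff)
    then show "\<forall>\<sigma>'\<in>D. rel_entropy \<rho> \<sigma> \<le> rel_entropy \<rho> \<sigma>'"
      using x \<psi> \<rho> by (intro ballI witness_imp_closest_state[OF D_states \<open>\<sigma> \<in> D\<close> assms(5)]) auto
  qed
qed

end
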